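(* Assume that $n_{\mathrm{per}}\ge2$, $\sum_n r_n=+\infty$ and $\sum_n r_n(1-r_n)<+\infty$. Then: (a) the limit set of each cyclic class is given by the barrier-set $\{0,1\}$, in the sense that $Z_{n,h}^{(c)}(1-Z_{n,h}^{(c)})\to0$ almost surely for each $h=0,\dots,n_{\mathrm{per}}-1$; (b) for any fixed $\epsilon\in(0,1/2)$, we have $\mathrm{card}\{h:\,Z_{n,h}^{(c)}\ge1-\epsilon\}\to N_\infty$ almost surely and $\mathrm{card}\{h:\,Z_{n,h}^{(c)}\le\epsilon\}\to n_{\mathrm{per}}-N_\infty$ almost surely, where $N_\infty$ is a random variable taking values in $\{0,1,\dots,n_{\mathrm{per}}\}$ with $P(N_\infty=0)+P(N_\infty=n_{\mathrm{per}})<1$.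
   Context: Let $N\ge 2$, $V=\{1,\dots,N\}$, and let $W=[w_{l_1,l_2}]_{l_1,l_2\in V}$ be an irreducible real matrix with non-negative entries such that $W^\top\mathbf{1}=\mathbf{1}$, where $\mathbf{1}$ is the all-ones vector ($\mathbf{0}$ is the zero vector). Let $(r_n)_{n\ge0}$ be a deterministic sequence with $0\le r_n<1$. Let $\mathbf{Z}_0=[Z_{0,1},\dots,Z_{0,N}]^\top$ be a random vector with values in $[0,1]^N$ such that $P(\mathbf{Z}_0=\mathbf{0})+P(\mathbf{Z}_0=\mathbf{1})<1$ and, for $n\ge 0$, let $\mathcal{F}_n=\sigma(Z_{0,l}:l\in V)\vee\sigma(X_{k,l}:1\le k\le n,\,l\in V)$. Given $\mathcal{F}_n$, the random variables $X_{n+1,l}$, $l\in V$, are $\{0,1\}$-valued and conditionally independent with $P(X_{n+1,l}=1\mid\mathcal{F}_n)=\sum_{l_1=1}^N w_{l_1,l}Z_{n,l_1}=[W^\top\mathbf{Z}_n]_l$, and $\mathbf{Z}_{n+1}=(1-r_n)\mathbf{Z}_n+r_n\mathbf{X}_{n+1}$, where $\mathbf{X}_{n}=[X_{n,1},\dots,X_{n,N}]^\top$, $\mathbf{Z}_{n}=[Z_{n,1},\dots,Z_{n,N}]^\top$. Let $n_{\mathrm{per}}\ge1$ be the period of the irreducible matrix $W^\top$ ($\gcd\{k\ge1:[(W^\top)^k]_{l,l}>0\}$, independent of $l$). The set $V$ is partitioned into $n_{\mathrm{per}}$ cyclic classes, numbered $0,\dots,n_{\mathrm{per}}-1$ (numbers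 modulo $n_{\mathrm{per}}$), such that $[W^\top]_{l_1,l_2}=0$ when $l_1$ is in class $h$ and $l_2$ is not in class $h+1$; they are the communicating classes of $(W^\top)^{n_{\mathrm{per}}}$. Let $\mathbf{v}$ be the unique vector with strictly positive entries with $\mathbf{v}^\top W^\top=\mathbf{v}^\top$ and $\mathbf{v}^\top\mathbf{1}=1$. For $h=0,\dots,n_{\mathrm{per}}-1$ define $$Z_{n,h}^{(c)}=\sum_{l_1\in\text{cyclic class }h}\frac{v_{l_1}}{\sum_{l_2\in\text{cyclic class }h}v_{l_2}}\,Z_{n,l_1}.$$ *)

theory Defs
  imports "HOL-Probability.Probability"
begin

primrec matpow :: "real^'n^'n \<Rightarrow> nat \<Rightarrow> real^'n^'n" where
  "matpow A 0 = mat 1"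
| "matpow A (Suc k) = A ** matpow A k"

text \<open>Irreducibility in the sense used for matrices with non-negative entries; the definition is
  only meaningful for such matrices.\<close>

definition irreducible_nonneg :: "real^'n^'n \<Rightarrow> bool" where
  "irreducible_nonneg A \<longleftrightarrow> (\<forall>i j. \<exists>k\<ge>1. matpow A k $ i $ j > 0)"

definition index_period :: "real^'n^'n \<Rightarrow> 'n \<Rightarrow> nat" where
  "index_period A l = Gcd {k. k \<ge> 1 \<and> matpow A k $ l $ l > 0}"

text \<open>The common value of the periods of all indices; lemma \<open>period_eq_index_period\<close> below
  shows that it exists for irreducible matrices with non-negative entries.\<close>

definition period :: "real^'n^'n \<Rightarrow> nat" where
  "period A = (THE d. \<forall>l. index_period A l = d)"

definition communicate :: "real^'n^'n \<Rightarrow> 'n \<Rightarrow> 'n \<Rightarrow> bool" where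
  "communicate A i j \<longleftrightarrow> (\<exists>k. matpow A k $ i $ j > 0) \<and> (\<exists>k. matpow A k $ j $ i > 0)"

text \<open>A numbering of the cyclic classes is given as the map \<open>c\<close> sending an index to the number of
  the class containing it. It is unique only up to a cyclic shift.\<close>

definition cyclic_numbering :: "real^'n^'n \<Rightarrow> ('n \<Rightarrow> nat) \<Rightarrow> bool" where
  "cyclic_numbering A c \<longleftrightarrow>
     range c = {0..<period A} \<and>
     (\<forall>i j. c j \<noteq> (c i + 1) mod period A \<longrightarrow> A $ i $ j = 0) \<and>
     (\<forall>i j. c i = c j \<longleftrightarrow> communicate (matpow A (period A)) i j)"

definition class_mean :: "real^'n \<Rightarrow> ('n \<Rightarrow> nat) \<Rightarrow> real^'n \<Rightarrow> nat \<Rightarrow> real" where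
  "class_mean v c z h = (\<Sum>i\<in>{i. c i = h}. v $ i / (\<Sum>j\<in>{j. c j = h}. v $ j) * z $ i)"

text \<open>The sigma-algebra generated by \<open>Z0\<close> and \<open>X 1, \<dots>, X n\<close>; the value \<open>X 0\<close> is not used.\<close>

definition history ::
  "'a measure \<Rightarrow> ('a \<Rightarrow> real^'n) \<Rightarrow> (nat \<Rightarrow> 'a \<Rightarrow> real^'n) \<Rightarrow> nat \<Rightarrow> 'a measure" where
  "history M Z0 X n = sigma (space M)
     ({{\<omega> \<in> space M. Z0 \<omega> $ l \<in> B} | l B. B \<in> sets borel} \<union>
      {{\<omega> \<in> space M. X k \<omega> $ l \<in> B} | k l B. 1 \<le> k \<and> k \<le> n \<and> B \<in> sets borel})"

definition cond_indep_vars ::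
  "'a measure \<Rightarrow> 'a measure \<Rightarrow> ('i \<Rightarrow> 'a \<Rightarrow> real) \<Rightarrow> 'i set \<Rightarrow> bool" where
  "cond_indep_vars M F Y I \<longleftrightarrow>
     (\<forall>J B. finite J \<and> J \<subseteq> I \<and> (\<forall>j\<in>J. B j \<in> sets borel) \<longrightarrow>
       (AE \<omega> in M. real_cond_exp M F (indicator {\<omega> \<in> space M. \<forall>j\<in>J. Y j \<omega> \<in> B j}) \<omega> =
          (\<Prod>j\<in>J. real_cond_exp M F (indicator {\<omega> \<in> space M. Y j \<omega> \<in> B j}) \<omega>)))"

lemma matpow_add: "matpow A (m + n) = matpow A m ** matpow A n"
  by (induction m) (simp_all add: matrix_mul_assoc)

lemma matpow_nonneg:
  assumes "\<And>i j. A $ i $ j \<ge> 0"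
  shows "matpow A k $ i $ j \<ge> 0"
  using assms
  by (induction k arbitrary: i j)
     (auto simp: mat_def matrix_matrix_mult_def intro!: sum_nonneg)

lemma matpow_add_pos:
  assumes "\<And>i j. A $ i $ j \<ge> 0" and "matpow A m $ i $ j > 0" and "matpow A n $ j $ k > 0"
  shows "matpow A (m + n) $ i $ k > 0"
proof -
  have "0 < matpow A m $ i $ j * matpow A n $ j $ k"
    using assms by simp
  also have "\<dots> \<le> (\<Sum>l\<in>UNIV. matpow A m $ i $ l * matpow A n $ l $ k)"
    by (rule member_le_sum) (auto intro!: mult_nonneg_nonneg matpow_nonneg assms(1))
  finally show ?thesis
    by (simp add: matpow_add matrix_matrix_mult_def)
qed

lemma period_eq_index_period:
  assumes nonneg: "\<And>i j. A $ i $ j \<ge> 0" and irr: "irreducible_nonneg A"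
  shows "period A = index_period A l"
proof -
  have dvd: "index_period A i dvd index_period A j" for i j
    unfolding index_period_def[of A j]
  proof (rule Gcd_greatest)
    fix k assume "k \<in> {k. k \<ge> 1 \<and> matpow A k $ j $ j > 0}"
    then have k: "matpow A k $ j $ j > 0" by simp
    obtain m where m: "m \<ge> 1" "matpow A m $ i $ j > 0"
      using irr unfolding irreducible_nonneg_def by blast
    obtain n where n: "n \<ge> 1" "matpow A n $ j $ i > 0"
      using irr unfolding irreducible_nonneg_def by blast
    have "matpow A (m + n) $ i $ i > 0"
      by (rule matpow_add_pos[OF nonneg m(2) n(2)])
    then have 1: "index_period A i dvd m + n"
      using m(1) unfolding index_period_def by (intro Gcd_dvd) simp
    have "matpow A (m + k + n) $ i $ i > 0"
      by (rule matpow_add_pos[OF nonneg matpow_add_pos[OF nonneg m(2) k] n(2)])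
    then have "index_period A i dvd m + k + n"
      using m(1) unfolding index_period_def by (intro Gcd_dvd) simp
    then have "index_period A i dvd k + (m + n)"
      by (simp add: ac_simps)
    with 1 show "index_period A i dvd k"
      by (simp add: dvd_add_left_iff)
  qed
  have "index_period A i = index_period A l" for i
    by (rule dvd_antisym) (rule dvd)+
  then show ?thesis
    unfolding period_def by (intro the_equality) auto
qed

end

theory Submission
  imports Defs
begin

text \<open>Write \<open>P\<close> for the transpose of \<open>W\<close>, \<open>\<xi>\<close> for the noise \<open>X (Suc n) - P *v Z n\<close> and \<open>Y h\<close> for the
  mean over class \<open>h\<close>. Pathwise, \<open>x (1 - x)\<close> of every component tends to 0. The second moment of the
  martingale \<open>v \<bullet> Z n\<close> grows by a multiple of the second moment of \<open>r n \<xi>\<close>, so \<open>r n \<xi>\<close> tends to 0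
  almost surely. Since \<open>r n\<close> is essentially 0 or 1, the path then follows \<open>z \<mapsto> P *v z\<close> along the
  times with \<open>r n\<close> near 1, so the components of \<open>P\<^sup>m *v Z n\<close> also approach \<open>{0, 1}\<close> for every \<open>m\<close>.
  An average of near 0/1 values is itself near 0/1 only if the values agree; as two indices of one
  class are reached from a common index in equally many steps, each class synchronizes. The sum
  of the \<open>Y h\<close> is then nearly an integer with vanishing increments, hence converges to an integer.

  For the nontriviality, suppose that all classes synchronize with each other. The expected
  \<open>L\<^sup>1\<close>-norm of the differences of consecutive \<open>Y h\<close> decreases in one step at most by the factor
  \<open>\<bar>1 - 2 r n\<bar> \<ge> 1 - 4 r n (1 - r n)\<close>, and these factors have a positive product from some time on.
  So the norm, which tends to 0, is 0 from that time on; then the noise vanishes, the state is a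
  harmonic 0/1 vector, and so was the initial state.\<close>

section \<open>The polynomial x (1 - x)\<close>

text \<open>With mean \<open>m\<close> and second moment \<open>s\<close>, write
  \<open>m - m * m = (m - s) + (s - m * m)\<close>; the last term is the variance, which is half the
  weighted mean of the squared differences.\<close>

lemma weighted_average_logistic:
  fixes p x :: "'i \<Rightarrow> real"
  assumes "finite I" and p1: "(\<Sum>i\<in>I. p i) = 1"
  shows "(\<Sum>i\<in>I. p i * x i) * (1 - (\<Sum>i\<in>I. p i * x i)) =
    (\<Sum>i\<in>I. p i * (x i * (1 - x i))) + (\<Sum>i\<in>I. \<Sum>j\<in>I. p i * p j * (x i - x j)\<^sup>2) / 2"
proof -
  define m s where "m = (\<Sum>i\<in>I. p i * x i)" and "s = (\<Sum>i\<in>I. p i * (x i)\<^sup>2)"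
  have "(\<Sum>i\<in>I. \<Sum>j\<in>I. p i * p j * (x i - x j)\<^sup>2) =
      (\<Sum>i\<in>I. \<Sum>j\<in>I. p i * (x i)\<^sup>2 * p j + p i * (p j * (x j)\<^sup>2) - 2 * (p i * x i) * (p j * x j))"
    by (intro sum.cong refl) (simp add: power2_eq_square algebra_simps)
  also have "\<dots> = (\<Sum>i\<in>I. p i * (x i)\<^sup>2 + s * p i - 2 * m * (p i * x i))"
  proof (intro sum.cong refl)
    fix i
    have "(\<Sum>j\<in>I. p i * (x i)\<^sup>2 * p j + p i * (p j * (x j)\<^sup>2) - 2 * (p i * x i) * (p j * x j)) =
        p i * (x i)\<^sup>2 * (\<Sum>j\<in>I. p j) + p i * s - 2 * (p i * x i) * m"
      unfolding sum_subtractf sum.distrib m_def s_def sum_distrib_left ..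
    then show "(\<Sum>j\<in>I. p i * (x i)\<^sup>2 * p j + p i * (p j * (x j)\<^sup>2) - 2 * (p i * x i) * (p j * x j)) =
        p i * (x i)\<^sup>2 + s * p i - 2 * m * (p i * x i)"
      by (simp add: p1)
  qed
  also have "\<dots> = s + s - 2 * m * m"
    unfolding sum_subtractf sum.distrib sum_distrib_left[symmetric] p1 m_def s_def by simp
  finally have "(\<Sum>i\<in>I. \<Sum>j\<in>I. p i * p j * (x i - x j)\<^sup>2) = 2 * (s - m * m)" by simp
  moreover have "(\<Sum>i\<in>I. p i * (x i * (1 - x i))) = m - s"
    by (simp add: m_def s_def sum_subtractf[symmetric] power2_eq_square algebra_simps)
  ultimately show ?thesis
    by (simp add: m_def[symmetric] algebra_simps)
qed

text \<open>Jensen's inequality for the concave function \<open>t * (1 - t)\<close>; the defect is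
  the nonnegative double sum of the preceding identity.\<close>

lemma average_logistic_le:
  fixes p x :: "'i \<Rightarrow> real"
  assumes "finite I" "(\<Sum>i\<in>I. p i) = 1" and "\<And>i. i \<in> I \<Longrightarrow> 0 \<le> p i"
  shows "(\<Sum>i\<in>I. p i * (x i * (1 - x i))) \<le> (\<Sum>i\<in>I. p i * x i) * (1 - (\<Sum>i\<in>I. p i * x i))"
proof -
  have "0 \<le> (\<Sum>i\<in>I. \<Sum>j\<in>I. p i * p j * (x i - x j)\<^sup>2)"
    using assms(3) by (intro sum_nonneg) auto
  then show ?thesis
    using weighted_average_logistic[OF assms(1,2), of x] by linarith
qed

text \<open>Keeps only the pair \<open>(a, b)\<close> of the double sum. Its use: an average close
  to 0 or 1 forces any two values of positive weight to be close to each other.\<close>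

lemma square_diff_le_average_logistic:
  fixes p x :: "'i \<Rightarrow> real"
  assumes "finite I" "(\<Sum>i\<in>I. p i) = 1" and p: "\<And>i. i \<in> I \<Longrightarrow> 0 \<le> p i"
    and x: "\<And>i. i \<in> I \<Longrightarrow> 0 \<le> x i \<and> x i \<le> 1" and ab: "a \<in> I" "b \<in> I"
  shows "p a * p b * (x a - x b)\<^sup>2 \<le> 2 * ((\<Sum>i\<in>I. p i * x i) * (1 - (\<Sum>i\<in>I. p i * x i)))"
proof -
  have "p a * p b * (x a - x b)\<^sup>2 \<le> (\<Sum>j\<in>I. p a * p j * (x a - x j)\<^sup>2)"
    using p ab assms(1) by (intro member_le_sum[of b I "\<lambda>j. p a * p j * (x a - x j)\<^sup>2"]) auto
  also have "\<dots> \<le> (\<Sum>i\<in>I. \<Sum>j\<in>I. p i * p j * (x i - x j)\<^sup>2)"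
    using p ab assms(1)
    by (intro member_le_sum[of a I "\<lambda>i. \<Sum>j\<in>I. p i * p j * (x i - x j)\<^sup>2"]) (auto intro!: sum_nonneg)
  finally have "p a * p b * (x a - x b)\<^sup>2 \<le> (\<Sum>i\<in>I. \<Sum>j\<in>I. p i * p j * (x i - x j)\<^sup>2)" .
  moreover have "0 \<le> (\<Sum>i\<in>I. p i * (x i * (1 - x i)))"
    using p x by (intro sum_nonneg) auto
  ultimately show ?thesis
    using weighted_average_logistic[OF assms(1,2), of x] by linarith
qed

text \<open>The variance identity for the two points \<open>x\<close> and \<open>b\<close>: as
  \<open>b * (1 - b) = 0\<close>, the only new term is \<open>r * (1 - r)\<close> times the square
  of \<open>x - b\<close>, which is at most 1.\<close>

lemma logistic_reinforcement_step:
  fixes x r b :: real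
  assumes "0 \<le> x" "x \<le> 1" "0 \<le> r" "r \<le> 1" "b \<in> {0, 1}" and y: "y = (1 - r) * x + r * b"
  shows "y * (1 - y) \<le> (1 - r) * (x * (1 - x)) + r * (1 - r)"
proof (cases "b = 0")
  case True
  have "y * (1 - y) = (1 - r) * (x * (1 - x)) + r * (1 - r) * x\<^sup>2"
    unfolding y True by (simp add: power2_eq_square algebra_simps)
  also have "x\<^sup>2 \<le> 1" using assms by (simp add: power_le_one)
  then have "r * (1 - r) * x\<^sup>2 \<le> r * (1 - r) * 1"
    using assms by (intro mult_left_mono) auto
  finally show ?thesis by simp
next
  case False
  then have b: "b = 1" using assms by auto
  have "y * (1 - y) = (1 - r) * (x * (1 - x)) + r * (1 - r) * (1 - x)\<^sup>2"
    unfolding y b by (simp add: power2_eq_square algebra_simps)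
  also have "(1 - x)\<^sup>2 \<le> 1" using assms by (simp add: power_le_one)
  then have "r * (1 - r) * (1 - x)\<^sup>2 \<le> r * (1 - r) * 1"
    using assms by (intro mult_left_mono) auto
  finally show ?thesis by simp
qed

text \<open>\<open>x * (1 - x)\<close> and \<open>y * (1 - y)\<close> differ by
  \<open>(x - y) * (1 - x - y)\<close>, whose second factor is at most 1 in absolute value.\<close>

lemma logistic_tendsto_transfer:
  fixes x y :: "nat \<Rightarrow> real"
  assumes x: "\<And>n. 0 \<le> x n \<and> x n \<le> 1" and y: "\<And>n. 0 \<le> y n \<and> y n \<le> 1"
    and d: "(\<lambda>n. x n - y n) \<longlonglongrightarrow> 0" and lim: "(\<lambda>n. x n * (1 - x n)) \<longlonglongrightarrow> 0"
  shows "(\<lambda>n. y n * (1 - y n)) \<longlonglongrightarrow> 0"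
proof -
  have "(\<lambda>n. (x n - y n) * (1 - x n - y n)) \<longlonglongrightarrow> 0"
  proof (rule tendsto_rabs_zero_cancel, rule Lim_null_comparison[OF _ tendsto_rabs_zero[OF d]])
    have "\<bar>(x n - y n) * (1 - x n - y n)\<bar> \<le> \<bar>x n - y n\<bar> * 1" for n
      unfolding abs_mult using x[of n] y[of n] by (intro mult_left_mono) auto
    then show "\<forall>\<^sub>F n in sequentially. norm \<bar>(x n - y n) * (1 - x n - y n)\<bar> \<le> \<bar>x n - y n\<bar>"
      by simp
  qed
  from tendsto_diff[OF lim this] show ?thesis
    by (simp add: algebra_simps)
qed

text \<open>In the first bound the error is \<open>1 - y\<close> above the threshold, where
  \<open>y \<ge> \<epsilon>\<close>, and \<open>y\<close> below it, where
  \<open>1 - y > \<epsilon>\<close>; either way, multiplied by \<open>\<epsilon>\<close> it is at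
  most \<open>y * (1 - y)\<close>. The second bound is symmetric.\<close>

lemma threshold_indicator_diff_le:
  fixes y \<epsilon> :: real
  assumes "0 < \<epsilon>" "\<epsilon> < 1 / 2" "0 \<le> y" "y \<le> 1"
  shows "\<bar>of_bool (1 - \<epsilon> \<le> y) - y\<bar> \<le> y * (1 - y) / \<epsilon>"
    and "\<bar>of_bool (y \<le> \<epsilon>) - (1 - y)\<bar> \<le> y * (1 - y) / \<epsilon>"
proof -
  have *: "\<epsilon> * (1 - y) \<le> y * (1 - y)" if "\<epsilon> \<le> y"
    using that assms by (intro mult_right_mono) auto
  have **: "\<epsilon> * y \<le> y * (1 - y)" if "y \<le> 1 - \<epsilon>"
    using mult_left_mono[of \<epsilon> "1 - y" y] that assms by (simp add: mult.commute)
  show "\<bar>of_bool (1 - \<epsilon> \<le> y) - y\<bar> \<le> y * (1 - y) / \<epsilon>"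
    using * ** assms by (cases "1 - \<epsilon> \<le> y") (simp_all add: field_simps)
  show "\<bar>of_bool (y \<le> \<epsilon>) - (1 - y)\<bar> \<le> y * (1 - y) / \<epsilon>"
    using * ** assms by (cases "y \<le> \<epsilon>") (simp_all add: field_simps)
qed

section \<open>Matrix powers and the period\<close>

text \<open>The differences of elements of an additive semigroup form the nonnegative half of a
  subgroup of the integers. Its generator divides all of \<open>S\<close>, hence
  \<open>Gcd S\<close>, hence \<open>L\<close>.\<close>

lemma Gcd_dvd_imp_difference:
  fixes S :: "nat set"
  assumes add: "\<And>a b. a \<in> S \<Longrightarrow> b \<in> S \<Longrightarrow> a + b \<in> S" and ne: "S \<noteq> {}" and L: "Gcd S dvd L"
  shows "\<exists>a\<in>S. a + L \<in> S"
proof -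
  define D where "D = {k. \<exists>a\<in>S. a + k \<in> S}"
  have S_D: "S \<subseteq> D" using add by (auto simp: D_def)
  have D0: "0 \<in> D" using ne by (auto simp: D_def)
  have D_add: "k + l \<in> D" if kl: "k \<in> D" "l \<in> D" for k l
  proof -
    obtain a b where "a \<in> S" "a + k \<in> S" "b \<in> S" "b + l \<in> S" using kl by (auto simp: D_def)
    then have "a + b \<in> S" "(a + k) + (b + l) \<in> S" using add by blast+
    then show ?thesis unfolding D_def by (auto simp: ac_simps intro!: bexI[of _ "a + b"])
  qed
  have D_diff: "k - l \<in> D" if kl: "k \<in> D" "l \<in> D" "l \<le> k" for k l
  proof -
    obtain a b where "a \<in> S" "a + k \<in> S" "b \<in> S" "b + l \<in> S" using kl by (auto simp: D_def)
    then have "a + (b + l) \<in> S" "(a + k) + b \<in> S" using add by blast+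
    moreover have "a + (b + l) + (k - l) = (a + k) + b" using kl(3) by simp
    ultimately have "a + (b + l) \<in> S" "a + (b + l) + (k - l) \<in> S" by argo+
    then show ?thesis unfolding D_def by blast
  qed
  have D_mult: "q * k \<in> D" if "k \<in> D" for q k
    using that by (induction q) (auto simp: D0 intro: D_add)
  \<comment> \<open>The generator is 0 if \<open>D\<close> is trivial and the least positive element
    otherwise, by division with remainder.\<close>
  have "\<exists>g\<in>D. \<forall>k\<in>D. g dvd k"
  proof (cases "D \<subseteq> {0}")
    case True
    then show ?thesis using D0 by (intro bexI[of _ 0]) auto
  next
    case False
    define g where "g = (LEAST k. k \<in> D \<and> k > 0)"
    have "\<exists>k. k \<in> D \<and> k > 0" using False by auto
    then have g: "g \<in> D" "g > 0" unfolding g_def by (metis (mono_tags, lifting) LeastI_ex)+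
    have "g dvd k" if k: "k \<in> D" for k
    proof (rule ccontr)
      assume "\<not> g dvd k"
      then have "k mod g > 0" by (simp add: mod_greater_zero_iff_not_dvd)
      moreover have "k mod g \<in> D"
        using D_diff[OF k D_mult[OF g(1), of "k div g"]] by (simp add: minus_div_mult_eq_mod)
      ultimately have "g \<le> k mod g" unfolding g_def by (intro Least_le) auto
      then show False using mod_less_divisor[OF g(2), of k] by simp
    qed
    then show ?thesis using g by blast
  qed
  then obtain g where g: "g \<in> D" "\<And>k. k \<in> D \<Longrightarrow> g dvd k" by blast
  have "g dvd Gcd S" using g(2) S_D by (intro Gcd_greatest) auto
  then have "g dvd L" using L by (rule dvd_trans)
  then have "L \<in> D" using D_mult[OF g(1)] by (auto simp: mult.commute elim!: dvdE)
  then show ?thesis by (simp add: D_def)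
qed

lemma matpow_mult: "matpow (matpow A d) k = matpow A (d * k)"
  by (induction k) (simp_all add: matpow_add)

lemma matpow_transpose: "matpow (transpose A) k = transpose (matpow A k)"
proof (induction k)
  case (Suc k)
  have "matpow A (Suc k) = matpow A k ** A"
    using matpow_add[of A k 1] by simp
  with Suc show ?case by (simp add: matrix_transpose_mul)
qed (simp add: transpose_mat)

lemma irreducible_nonneg_transpose:
  "irreducible_nonneg A \<Longrightarrow> irreducible_nonneg (transpose A)"
  unfolding irreducible_nonneg_def matpow_transpose by (simp add: transpose_def)

lemma matpow_row_sum:
  assumes "\<And>i. (\<Sum>j\<in>UNIV. A $ i $ j) = 1"
  shows "(\<Sum>j\<in>UNIV. matpow A k $ i $ j) = 1"
proof (induction k arbitrary: i)
  case 0
  show ?case by (simp add: mat_def)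
next
  case (Suc k)
  have "(\<Sum>j\<in>UNIV. matpow A (Suc k) $ i $ j) = (\<Sum>l\<in>UNIV. A $ i $ l * (\<Sum>j\<in>UNIV. matpow A k $ l $ j))"
    unfolding sum_distrib_left by (subst sum.swap) (simp add: matrix_matrix_mult_def)
  then show ?case using Suc assms by simp
qed

text \<open>The return times to \<open>i\<close> form an additive semigroup whose gcd is the period,
  and some path from \<open>i\<close> to \<open>j\<close> has a multiple of the period as its length
  \<open>L\<close>. Hence \<open>L\<close> is a difference of two return times \<open>a\<close> and
  \<open>a + L\<close>, and \<open>m = a + L\<close> allows both a return to \<open>i\<close> and a
  return in \<open>a\<close> steps followed by the path to \<open>j\<close>.\<close>

lemma cyclic_class_common_predecessor:
  assumes nonneg: "\<And>i j. A $ i $ j \<ge> 0" and irr: "irreducible_nonneg A"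
    and c: "cyclic_numbering A c" and ij: "c i = c j"
  shows "\<exists>m. matpow A m $ i $ i > 0 \<and> matpow A m $ i $ j > 0"
proof -
  define S where "S = {k. k \<ge> 1 \<and> matpow A k $ i $ i > 0}"
  have "communicate (matpow A (period A)) i j"
    using c ij by (auto simp: cyclic_numbering_def)
  then obtain k where k: "matpow A (period A * k) $ i $ j > 0"
    by (auto simp: communicate_def matpow_mult)
  have "period A = Gcd S"
    using period_eq_index_period[OF nonneg irr, of i] by (simp add: index_period_def S_def)
  then have "Gcd S dvd period A * k" by simp
  moreover have "a + b \<in> S" if "a \<in> S" "b \<in> S" for a b
    using that matpow_add_pos[OF nonneg, of a i i b i] by (auto simp: S_def)
  moreover have "S \<noteq> {}"
    using irr by (auto simp: S_def irreducible_nonneg_def)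
  ultimately obtain a where "a \<in> S" "a + period A * k \<in> S"
    using Gcd_dvd_imp_difference[of S] by blast
  then have "matpow A (a + period A * k) $ i $ i > 0" "matpow A (a + period A * k) $ i $ j > 0"
    using matpow_add_pos[OF nonneg _ k, of a i] by (auto simp: S_def)
  then show ?thesis by blast
qed

lemma stochastic_mult_range:
  assumes A: "\<And>i j. A $ i $ j \<ge> 0" "\<And>i. (\<Sum>j\<in>UNIV. A $ i $ j) = 1"
    and z: "\<And>i. a \<le> (z::real^'n) $ i \<and> z $ i \<le> b"
  shows "a \<le> (A *v z) $ i \<and> (A *v z) $ i \<le> b"
proof -
  have "(\<Sum>j\<in>UNIV. A $ i $ j * a) \<le> (\<Sum>j\<in>UNIV. A $ i $ j * z $ j)"
    "(\<Sum>j\<in>UNIV. A $ i $ j * z $ j) \<le> (\<Sum>j\<in>UNIV. A $ i $ j * b)"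
    using A z by (intro sum_mono mult_left_mono; simp)+
  then show ?thesis
    using A by (simp add: matrix_vector_mult_def sum_distrib_right[symmetric])
qed

text \<open>A minimum principle: at a zero of \<open>z\<close> every power of \<open>A\<close>
  averages nonnegative values to 0, so each index reachable from there, that is each index, carries
  the value 0.\<close>

lemma harmonic_01_trivial:
  fixes z :: "real^'n"
  assumes nonneg: "\<And>i j. A $ i $ j \<ge> 0" and irr: "irreducible_nonneg A"
    and harm: "A *v z = z" and z01: "\<And>i. z $ i \<in> {0, 1}"
  shows "z = 0 \<or> z = 1"
proof (cases "\<exists>i. z $ i = 0")
  case True
  then obtain i where i: "z $ i = 0" by blast
  have pow: "matpow A k *v z = z" for k
    by (induction k) (simp_all add: harm flip: matrix_vector_mul_assoc)
  have nn: "0 \<le> z $ j" for j using z01[of j] by auto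
  have "z $ j = 0" for j
  proof -
    obtain k where k: "matpow A k $ i $ j > 0"
      using irr by (auto simp: irreducible_nonneg_def)
    have "matpow A k $ i $ j * z $ j \<le> (\<Sum>l\<in>UNIV. matpow A k $ i $ l * z $ l)"
      using matpow_nonneg[of A, OF nonneg] nn
      by (intro member_le_sum[of j UNIV "\<lambda>l. matpow A k $ i $ l * z $ l"]) auto
    also have "\<dots> = 0" using pow[of k] i by (metis (no_types) matrix_vector_mult_def vec_lambda_beta)
    finally show ?thesis using k z01[of j] by (auto simp: mult_le_0_iff)
  qed
  then show ?thesis by (simp add: vec_eq_iff)
next
  case False
  then show ?thesis using z01 by (auto simp: vec_eq_iff)
qed

section \<open>Pathwise asymptotics\<close>

text \<open>\<open>\<tau> n\<close> is the first time from \<open>n\<close> on with rate at least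
  1/2, and \<open>T n\<close> is twice the tail of the series of \<open>r k * (1 - r k)\<close>. The
  factor 2 appears because \<open>r \<le> 2 * r * (1 - r)\<close> for \<open>r\<close> below 1/2 and
  \<open>1 - r \<le> 2 * r * (1 - r)\<close> for \<open>r\<close> above.\<close>

lemma eventually_zero_or_one_rates:
  fixes r :: "nat \<Rightarrow> real"
  assumes r: "\<And>n. 0 \<le> r n \<and> r n < 1"
    and r_div: "filterlim (\<lambda>n. \<Sum>k<n. r k) at_top sequentially"
    and r_sum: "summable (\<lambda>n. r n * (1 - r n))"
  shows "\<exists>\<tau> T. T \<longlonglongrightarrow> 0 \<and>
    (\<forall>n. n \<le> \<tau> n \<and> 1 - r (\<tau> n) \<le> T n \<and> (\<Sum>k\<in>{n..<\<tau> n}. r k) \<le> T n \<and>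
      (\<forall>m. (\<Sum>k\<in>{n..<m}. r k * (1 - r k)) \<le> T n))"
proof -
  define s where "s = (\<lambda>n. r n * (1 - r n))"
  define T where "T = (\<lambda>n. 2 * (suminf s - (\<Sum>k<n. s k)))"
  define \<tau> where "\<tau> = (\<lambda>n. LEAST a. n \<le> a \<and> 1 / 2 \<le> r a)"
  have s: "summable s" "\<And>n. 0 \<le> s n"
    using r_sum r by (auto simp: s_def less_imp_le intro!: mult_nonneg_nonneg)
  \<comment> \<open>Rates below 1/2 from \<open>n\<close> on would be dominated by
    \<open>2 * s k\<close>, so their sum would converge.\<close>
  have ex: "\<exists>a\<ge>n. 1 / 2 \<le> r a" for n
  proof (rule ccontr)
    assume "\<not> ?thesis"
    then have less: "r k < 1 / 2" if "k \<ge> n" for k using that by force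
    have "r k \<le> 2 * s k" if "k \<ge> n" for k
      using mult_left_mono[of 1 "2 * (1 - r k)" "r k"] less[OF that] r[of k] by (simp add: s_def algebra_simps)
    then have "summable r"
      using r by (intro summable_comparison_test[OF _ summable_mult[OF s(1), of 2]]) auto
    then have "(\<lambda>n. \<Sum>k<n. r k) \<longlonglongrightarrow> suminf r" by (rule summable_LIMSEQ)
    with r_div show False
      using not_tendsto_and_filterlim_at_infinity[OF sequentially_bot]
        filterlim_at_top_imp_at_infinity by blast
  qed
  have \<tau>: "n \<le> \<tau> n" "1 / 2 \<le> r (\<tau> n)" for n
    using LeastI_ex[of "\<lambda>a. n \<le> a \<and> 1 / 2 \<le> r a"] ex[of n] by (auto simp: \<tau>_def)
  have before: "r k \<le> 2 * s k" if "k \<in> {n..<\<tau> n}" for n k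
  proof -
    have "r k < 1 / 2"
      using not_less_Least[of k "\<lambda>a. n \<le> a \<and> 1 / 2 \<le> r a"] that by (auto simp: \<tau>_def)
    then show ?thesis
      using mult_left_mono[of 1 "2 * (1 - r k)" "r k"] r[of k] by (simp add: s_def algebra_simps)
  qed
  have tail: "2 * (\<Sum>k\<in>{n..<m}. s k) \<le> T n" for n m
  proof -
    have "(\<Sum>k\<in>{n..<m}. s k) + (\<Sum>k<n. s k) = (\<Sum>k\<in>{n..<m} \<union> {..<n}. s k)"
      by (subst sum.union_disjoint) auto
    also have "\<dots> \<le> suminf s" using s by (intro sum_le_suminf) auto
    finally show ?thesis by (simp add: T_def)
  qed
  show ?thesis
  proof (intro exI[of _ \<tau>] exI[of _ T] conjI allI)
    show "n \<le> \<tau> n" for n by (fact \<tau>)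
    have "(\<lambda>n. suminf s - (\<Sum>k<n. s k)) \<longlonglongrightarrow> suminf s - suminf s"
      by (intro tendsto_diff tendsto_const summable_LIMSEQ s)
    from tendsto_mult_left[OF this, of 2] show "T \<longlonglongrightarrow> 0" by (simp add: T_def)
    show "1 - r (\<tau> n) \<le> T n" for n
    proof -
      have "s (\<tau> n) \<le> (\<Sum>k\<in>{n..<Suc (\<tau> n)}. s k)"
        using \<tau>(1)[of n] s by (intro member_le_sum) auto
      moreover have "1 - r (\<tau> n) \<le> 2 * s (\<tau> n)"
        using mult_right_mono[of 1 "2 * r (\<tau> n)" "1 - r (\<tau> n)"] \<tau>(2)[of n] r[of "\<tau> n"]
        by (simp add: s_def algebra_simps)
      ultimately show ?thesis using tail[of n "Suc (\<tau> n)"] by linarith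
    qed
    show "(\<Sum>k\<in>{n..<\<tau> n}. r k) \<le> T n" for n
    proof -
      have "(\<Sum>k\<in>{n..<\<tau> n}. r k) \<le> (\<Sum>k\<in>{n..<\<tau> n}. 2 * s k)"
        by (intro sum_mono before)
      then show ?thesis using tail[of n "\<tau> n"] by (simp add: sum_distrib_left)
    qed
    show "(\<Sum>k\<in>{n..<m}. r k * (1 - r k)) \<le> T n" for n m
      using tail[of n m] sum_nonneg[of "{n..<m}" s] s(2) by (auto simp: s_def)
  qed
qed

lemma abs_diff_le_sum_increments:
  fixes u :: "nat \<Rightarrow> real"
  assumes "n \<le> m" and "\<And>k. \<bar>u (Suc k) - u k\<bar> \<le> b k"
  shows "\<bar>u m - u n\<bar> \<le> (\<Sum>k\<in>{n..<m}. b k)"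
  using assms(1)
proof (induction m rule: dec_induct)
  case (step m)
  then show ?case using assms(2)[of m] by simp
qed simp

text \<open>Between the times with \<open>r n \<ge> 1/2\<close> the path moves only by a summable amount, and at
  those times it jumps to within a vanishing error of \<open>A *v z n\<close>.\<close>

lemma reinforced_path_logistic_matpow:
  fixes A :: "real^'n^'n" and z x :: "nat \<Rightarrow> real^'n" and r :: "nat \<Rightarrow> real"
  assumes A: "\<And>i j. A $ i $ j \<ge> 0" "\<And>i. (\<Sum>j\<in>UNIV. A $ i $ j) = 1"
    and r: "\<And>n. 0 \<le> r n \<and> r n < 1"
    and r_div: "filterlim (\<lambda>n. \<Sum>k<n. r k) at_top sequentially"
    and r_sum: "summable (\<lambda>n. r n * (1 - r n))"
    and z01: "\<And>n i. 0 \<le> z n $ i \<and> z n $ i \<le> 1"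
    and x01: "\<And>n i. x n $ i \<in> {0, 1}"
    and rec: "\<And>n. z (Suc n) = (1 - r n) *\<^sub>R z n + r n *\<^sub>R x n"
    and noise: "\<And>i. (\<lambda>n. r n * (x n - A *v z n) $ i) \<longlonglongrightarrow> 0"
  shows "(\<lambda>n. (matpow A m *v z n) $ l * (1 - (matpow A m *v z n) $ l)) \<longlonglongrightarrow> 0"
proof -
  obtain \<tau> T where \<tau>: "\<And>n. n \<le> \<tau> n" and T: "T \<longlonglongrightarrow> 0" and last: "\<And>n. 1 - r (\<tau> n) \<le> T n"
    and before: "\<And>n. (\<Sum>k\<in>{n..<\<tau> n}. r k) \<le> T n"
    and tail: "\<And>n m. (\<Sum>k\<in>{n..<m}. r k * (1 - r k)) \<le> T n"
    using eventually_zero_or_one_rates[OF r r_div r_sum] by metis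
  have recc: "z (Suc n) $ i = (1 - r n) * z n $ i + r n * x n $ i" for n i
    by (simp add: rec)
  have x_abs: "0 \<le> x n $ i \<and> x n $ i \<le> 1" for n i using x01[of n i] by auto
  have T0: "0 \<le> T n" for n using tail[of n n] by simp
  have drift: "\<bar>z (\<tau> n) $ i - z n $ i\<bar> \<le> T n" for n i
  proof -
    have "\<bar>z (Suc k) $ i - z k $ i\<bar> \<le> r k" for k
    proof -
      have "z (Suc k) $ i - z k $ i = r k * (x k $ i - z k $ i)"
        by (simp add: recc algebra_simps)
      then have "\<bar>z (Suc k) $ i - z k $ i\<bar> = r k * \<bar>x k $ i - z k $ i\<bar>"
        using r[of k] by (simp add: abs_mult)
      also have "\<dots> \<le> r k * 1"
        using r[of k] z01[of k i] x_abs[of k i] by (intro mult_left_mono) auto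
      finally show ?thesis by simp
    qed
    from abs_diff_le_sum_increments[of n "\<tau> n" "\<lambda>k. z k $ i", OF \<tau> this]
    show ?thesis using before[of n] by linarith
  qed
  have Az01: "0 \<le> (A *v z n) $ i \<and> (A *v z n) $ i \<le> 1" for n i
    using stochastic_mult_range[OF A, of 0 "z n" 1] z01 by blast
  have lim_\<tau>: "filterlim \<tau> at_top sequentially"
    using \<tau> by (intro filterlim_at_top_mono[OF filterlim_ident]) auto
  have \<tau>_Suc: "filterlim (\<lambda>n. Suc (\<tau> n)) at_top sequentially"
    using lim_\<tau> filterlim_Suc filterlim_compose by blast
  \<comment> \<open>The error made by treating the whole passage from \<open>n\<close> to
    \<open>Suc (\<tau> n)\<close> as one application of \<open>A\<close>.\<close>
  define D where "D = (\<lambda>n. z (Suc (\<tau> n)) - A *v z n)"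
  have D: "(\<lambda>n. D n $ i) \<longlonglongrightarrow> 0" for i
  proof (rule Lim_null_comparison)
    show "\<forall>\<^sub>F n in sequentially. norm (D n $ i) \<le> 2 * T n + \<bar>r (\<tau> n) * (x (\<tau> n) - A *v z (\<tau> n)) $ i\<bar>"
    proof (intro always_eventually allI)
      fix n
      have 1: "\<bar>(A *v z (\<tau> n)) $ i - (A *v z n) $ i\<bar> \<le> T n"
      proof -
        have "- T n \<le> (z (\<tau> n) - z n) $ i \<and> (z (\<tau> n) - z n) $ i \<le> T n" for i
          using drift[of n i] by (simp add: abs_le_iff)
        from stochastic_mult_range[OF A this, of i] show ?thesis
          unfolding matrix_vector_mult_diff_distrib vector_minus_component abs_le_iff by linarith
      qed
      \<comment> \<open>Three sources of error: the old state retained in the jump, the noise of the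
        jump, and the drift of the state between \<open>n\<close> and
        \<open>\<tau> n\<close>.\<close>
      have "D n $ i = (1 - r (\<tau> n)) * (z (\<tau> n) $ i - (A *v z (\<tau> n)) $ i)
          + r (\<tau> n) * (x (\<tau> n) - A *v z (\<tau> n)) $ i + ((A *v z (\<tau> n)) $ i - (A *v z n) $ i)"
        by (simp add: D_def recc algebra_simps)
      moreover have "\<bar>(1 - r (\<tau> n)) * (z (\<tau> n) $ i - (A *v z (\<tau> n)) $ i)\<bar> \<le> T n * 1"
        unfolding abs_mult using z01[of "\<tau> n" i] Az01[of "\<tau> n" i] last[of n] T0[of n] r[of "\<tau> n"]
        by (intro mult_mono) auto
      ultimately show "norm (D n $ i) \<le> 2 * T n + \<bar>r (\<tau> n) * (x (\<tau> n) - A *v z (\<tau> n)) $ i\<bar>"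
        using 1 by (simp only: real_norm_def)
    qed
    have "(\<lambda>n. r (\<tau> n) * (x (\<tau> n) - A *v z (\<tau> n)) $ i) \<longlonglongrightarrow> 0"
      using filterlim_compose[OF noise[of i] lim_\<tau>] .
    then show "(\<lambda>n. 2 * T n + \<bar>r (\<tau> n) * (x (\<tau> n) - A *v z (\<tau> n)) $ i\<bar>) \<longlonglongrightarrow> 0"
      using tendsto_add[OF tendsto_mult_left[OF T, of 2] tendsto_rabs_zero] by simp
  qed
  have f01: "0 \<le> t * (1 - t)" "t * (1 - t) \<le> 1" if "0 \<le> t \<and> t \<le> 1" for t :: real
    using that mult_mono[of t 1 "1 - t" 1] by auto
  have base: "(\<lambda>n. z n $ i * (1 - z n $ i)) \<longlonglongrightarrow> 0" for i
  proof -
    define g where "g = (\<lambda>n. z n $ i * (1 - z n $ i))"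
    have g_step: "g (Suc n) \<le> (1 - r n) * g n + r n * (1 - r n)" for n
      using logistic_reinforcement_step[OF _ _ _ _ x01[of n i] recc[of n i]] z01[of n i] r[of n]
      by (simp add: g_def)
    have g01: "0 \<le> g n" "g n \<le> 1" for n using f01[OF z01[of n i]] by (auto simp: g_def)
    \<comment> \<open>The jump at time \<open>\<tau> N\<close> leaves at most the fraction
      \<open>1 - r (\<tau> N)\<close> of the old value of \<open>g\<close>; from then on
      \<open>g\<close> grows by at most the terms \<open>r k * (1 - r k)\<close>.\<close>
    have bound: "g n \<le> 2 * T N" if "Suc (\<tau> N) \<le> n" for n N
    proof -
      have "g n \<le> (1 - r (\<tau> N)) + (\<Sum>k\<in>{\<tau> N..<n}. r k * (1 - r k))"
        using that
      proof (induction n rule: dec_induct)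
        case base
        have "(1 - r (\<tau> N)) * g (\<tau> N) \<le> (1 - r (\<tau> N)) * 1"
          using g01 r[of "\<tau> N"] by (intro mult_left_mono) auto
        then show ?case using g_step[of "\<tau> N"] by simp
      next
        case (step n)
        have "0 \<le> r n * g n" using r[of n] g01 by auto
        then show ?case using g_step[of n] step by (simp add: algebra_simps)
      qed
      also have "(\<Sum>k\<in>{\<tau> N..<n}. r k * (1 - r k)) \<le> (\<Sum>k\<in>{N..<n}. r k * (1 - r k))"
        using \<tau>[of N] r by (intro sum_mono2) (auto simp: less_imp_le intro!: mult_nonneg_nonneg)
      finally show ?thesis using last[of N] tail[of N n] by linarith
    qed
    have "g \<longlonglongrightarrow> 0"
    proof (rule LIMSEQ_I)
      fix e :: real assume e: "0 < e"
      have "eventually (\<lambda>n. T n < e / 2) sequentially"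
        using T e by (intro order_tendstoD(2)[of T 0]) auto
      then obtain N where "T N < e / 2" by (auto simp: eventually_sequentially)
      then show "\<exists>no. \<forall>n\<ge>no. norm (g n - 0) < e"
        using bound[of N] g01 by (intro exI[of _ "Suc (\<tau> N)"]) fastforce
    qed
    then show ?thesis by (simp add: g_def)
  qed
  have pow01: "0 \<le> (matpow A m *v z n) $ l \<and> (matpow A m *v z n) $ l \<le> 1" for m n l
    using stochastic_mult_range[OF matpow_nonneg[OF A(1)] matpow_row_sum[OF A(2)], of 0 "z n" 1] z01
    by blast
  show ?thesis
  proof (induction m arbitrary: l)
    case 0
    show ?case using base[of l] by simp
  next
    \<comment> \<open>The induction hypothesis is read along the times
      \<open>Suc (\<tau> n)\<close>, where the state is \<open>A *v z n\<close> up to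
      \<open>D n\<close>. Since \<open>\<tau> n\<close> is defined for each \<open>n\<close>, the
      conclusion holds along the full sequence.\<close>
    case (Suc m)
    have "(\<lambda>n. (matpow A m *v z (Suc (\<tau> n))) $ l * (1 - (matpow A m *v z (Suc (\<tau> n))) $ l)) \<longlonglongrightarrow> 0"
      using filterlim_compose[OF Suc[of l] \<tau>_Suc] .
    moreover have "(\<lambda>n. (matpow A m *v z (Suc (\<tau> n))) $ l - (matpow A (Suc m) *v z n) $ l) \<longlonglongrightarrow> 0"
    proof -
      have "(matpow A m *v z (Suc (\<tau> n))) $ l - (matpow A (Suc m) *v z n) $ l
          = (\<Sum>j\<in>UNIV. matpow A m $ l $ j * D n $ j)" for n
      proof -
        have "matpow A (Suc m) *v z n = matpow A m *v (A *v z n)"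
          using matpow_add[of A m 1] by (simp add: matrix_vector_mul_assoc)
        then have "matpow A m *v z (Suc (\<tau> n)) - matpow A (Suc m) *v z n = matpow A m *v D n"
          by (simp add: D_def matrix_vector_mult_diff_distrib)
        then show ?thesis
          by (simp add: matrix_vector_mult_def vec_eq_iff)
      qed
      moreover have "(\<lambda>n. \<Sum>j\<in>UNIV. matpow A m $ l $ j * D n $ j) \<longlonglongrightarrow> (\<Sum>j\<in>UNIV. matpow A m $ l $ j * 0)"
        by (intro tendsto_sum tendsto_mult tendsto_const D)
      ultimately show ?thesis by simp
    qed
    ultimately show ?case
      by (intro logistic_tendsto_transfer[where y = "\<lambda>n. (matpow A (Suc m) *v z n) $ l", OF pow01 pow01])
  qed
qed

text \<open>For \<open>i\<close> and \<open>j\<close> in one class, a suitable row of a matrix power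
  gives both positive weight, and the average along this row approaches \<open>{0, 1}\<close>; so
  the two components approach each other. The class mean is then an average of nearly equal values
  near 0 or 1.\<close>

lemma reinforced_path_class_synchronization:
  fixes A :: "real^'n^'n" and z x :: "nat \<Rightarrow> real^'n" and r :: "nat \<Rightarrow> real"
  assumes A: "\<And>i j. A $ i $ j \<ge> 0" "\<And>i. (\<Sum>j\<in>UNIV. A $ i $ j) = 1"
    and irr: "irreducible_nonneg A" and c: "cyclic_numbering A c" and v: "\<And>i. v $ i > 0"
    and r: "\<And>n. 0 \<le> r n \<and> r n < 1"
    and r_div: "filterlim (\<lambda>n. \<Sum>k<n. r k) at_top sequentially"
    and r_sum: "summable (\<lambda>n. r n * (1 - r n))"
    and z01: "\<And>n i. 0 \<le> z n $ i \<and> z n $ i \<le> 1"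
    and x01: "\<And>n i. x n $ i \<in> {0, 1}"
    and rec: "\<And>n. z (Suc n) = (1 - r n) *\<^sub>R z n + r n *\<^sub>R x n"
    and noise: "\<And>i. (\<lambda>n. r n * (x n - A *v z n) $ i) \<longlonglongrightarrow> 0"
    and h: "h < period A"
  shows "(\<lambda>n. class_mean v c (z n) h * (1 - class_mean v c (z n) h)) \<longlonglongrightarrow> 0"
proof -
  note lim = reinforced_path_logistic_matpow[OF A r r_div r_sum z01 x01 rec noise]
  define p where "p = (\<lambda>i. v $ i / (\<Sum>j\<in>{j. c j = h}. v $ j))"
  have "h \<in> range c" using c h by (simp add: cyclic_numbering_def)
  then have "0 < (\<Sum>j\<in>{j. c j = h}. v $ j)" using v by (intro sum_pos) auto
  then have p1: "(\<Sum>i\<in>{i. c i = h}. p i) = 1"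
    unfolding p_def sum_divide_distrib[symmetric] by simp
  have sync: "(\<lambda>n. (z n $ i - z n $ j)\<^sup>2) \<longlonglongrightarrow> 0" if ij: "c i = c j" for i j
  proof -
    obtain m where m: "matpow A m $ i $ i > 0" "matpow A m $ i $ j > 0"
      using cyclic_class_common_predecessor[OF A(1) irr c ij] by blast
    define t where "t = matpow A m $ i $ i * matpow A m $ i $ j"
    have t: "t > 0" using m by (simp add: t_def)
    show ?thesis
    proof (rule Lim_null_comparison)
      have "t * (z n $ i - z n $ j)\<^sup>2 \<le> 2 * ((matpow A m *v z n) $ i * (1 - (matpow A m *v z n) $ i))" for n
        using square_diff_le_average_logistic[of UNIV "\<lambda>j. matpow A m $ i $ j" "\<lambda>j. z n $ j" i j]
          matpow_nonneg[OF A(1)] matpow_row_sum[OF A(2)] z01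
        by (simp add: t_def matrix_vector_mult_def)
      then show "\<forall>\<^sub>F n in sequentially. norm ((z n $ i - z n $ j)\<^sup>2)
          \<le> 2 / t * ((matpow A m *v z n) $ i * (1 - (matpow A m *v z n) $ i))"
        using t by (simp add: field_simps)
      show "(\<lambda>n. 2 / t * ((matpow A m *v z n) $ i * (1 - (matpow A m *v z n) $ i))) \<longlonglongrightarrow> 0"
        using tendsto_mult_left[OF lim[of m i], of "2 / t"] by simp
    qed
  qed
  \<comment> \<open>The right-hand side of the variance identity for the class mean: the components
    themselves (the power \<open>m = 0\<close>) and their pairwise differences both contribute
    nothing in the limit.\<close>
  have "(\<lambda>n. (\<Sum>i\<in>{i. c i = h}. p i * (z n $ i * (1 - z n $ i)))
      + (\<Sum>i\<in>{i. c i = h}. \<Sum>j\<in>{i. c i = h}. p i * p j * (z n $ i - z n $ j)\<^sup>2) / 2)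
    \<longlonglongrightarrow> (\<Sum>i\<in>{i. c i = h}. p i * 0) + (\<Sum>i\<in>{i. c i = h}. \<Sum>j\<in>{i. c i = h}. p i * p j * 0) / 2"
    using lim[of 0]
    by (intro tendsto_add tendsto_divide tendsto_sum tendsto_mult[OF tendsto_const] sync tendsto_const) auto
  moreover have "class_mean v c (z n) h = (\<Sum>i\<in>{i. c i = h}. p i * z n $ i)" for n
    by (simp add: class_mean_def p_def)
  ultimately show ?thesis
    by (simp only: weighted_average_logistic[OF finite p1]) simp
qed

section \<open>The noise of the reinforced process\<close>

lemma component_borel_measurable:
  "f \<in> borel_measurable N \<Longrightarrow> (\<lambda>\<omega>. (f \<omega> :: real^'n) $ l) \<in> borel_measurable N"
  by (rule measurable_compose[OF _ borel_measurable_nth])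

text \<open>The dynamics alone, with \<open>P\<close> in the role of the transpose of
  \<open>W\<close>; the cyclic structure and the summability conditions enter in a second
  locale.\<close>

locale reinforced_process = prob_space M for M :: "'a measure" +
  fixes P :: "real^'n^'n" and r :: "nat \<Rightarrow> real" and Z X :: "nat \<Rightarrow> 'a \<Rightarrow> real^'n"
  assumes P_nonneg: "P $ i $ j \<ge> 0"
    and P_row_sum: "(\<Sum>j\<in>UNIV. P $ i $ j) = 1"
    and r_range: "0 \<le> r n \<and> r n < 1"
    and Z0_measurable: "Z 0 \<in> borel_measurable M"
    and Z0_range: "\<omega> \<in> space M \<Longrightarrow> 0 \<le> Z 0 \<omega> $ l \<and> Z 0 \<omega> $ l \<le> 1"
    and X_measurable: "X (Suc n) \<in> borel_measurable M"
    and X_range: "\<omega> \<in> space M \<Longrightarrow> X (Suc n) \<omega> $ l \<in> {0, 1}"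
    and X_indep: "cond_indep_vars M (history M (Z 0) X n) (\<lambda>l \<omega>. X (Suc n) \<omega> $ l) UNIV"
    and X_prob: "AE \<omega> in M. real_cond_exp M (history M (Z 0) X n)
        (indicator {\<omega> \<in> space M. X (Suc n) \<omega> $ l = 1}) \<omega> = (P *v Z n \<omega>) $ l"
    and Z_rec: "\<omega> \<in> space M \<Longrightarrow> Z (Suc n) \<omega> = (1 - r n) *\<^sub>R Z n \<omega> + r n *\<^sub>R X (Suc n) \<omega>"
begin

abbreviation F :: "nat \<Rightarrow> 'a measure" where "F \<equiv> history M (Z 0) X"

definition noise :: "nat \<Rightarrow> 'a \<Rightarrow> real^'n" where
  "noise n \<omega> = X (Suc n) \<omega> - P *v Z n \<omega>"

lemma Z_component_rec:
  "\<omega> \<in> space M \<Longrightarrow> Z (Suc n) \<omega> $ l = (1 - r n) * Z n \<omega> $ l + r n * X (Suc n) \<omega> $ l"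
  by (simp add: Z_rec)

lemma X_01: "\<omega> \<in> space M \<Longrightarrow> 0 \<le> X (Suc n) \<omega> $ l \<and> X (Suc n) \<omega> $ l \<le> 1"
  using X_range[of \<omega> n l] by auto

lemma Z_01: "\<omega> \<in> space M \<Longrightarrow> 0 \<le> Z n \<omega> $ l \<and> Z n \<omega> $ l \<le> 1"
proof (induction n)
  case (Suc n)
  have "(1 - r n) * Z n \<omega> $ l + r n * X (Suc n) \<omega> $ l \<le> (1 - r n) * 1 + r n * 1"
    using Suc X_01[of \<omega> n l] r_range[of n] by (intro add_mono mult_left_mono) auto
  moreover have "0 \<le> (1 - r n) * Z n \<omega> $ l + r n * X (Suc n) \<omega> $ l"
    using Suc X_01[of \<omega> n l] r_range[of n] by (intro add_nonneg_nonneg mult_nonneg_nonneg) auto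
  ultimately show ?case using Suc.prems by (simp add: Z_component_rec)
qed (simp add: Z0_range)

lemma PZ_01: "\<omega> \<in> space M \<Longrightarrow> 0 \<le> (P *v Z n \<omega>) $ l \<and> (P *v Z n \<omega>) $ l \<le> 1"
  using stochastic_mult_range[of P 0 "Z n \<omega>" 1 l] P_nonneg P_row_sum Z_01 by blast

lemma noise_abs_le: "\<omega> \<in> space M \<Longrightarrow> \<bar>noise n \<omega> $ l\<bar> \<le> 1"
  using X_01[of \<omega> n l] PZ_01[of \<omega> n l] by (simp add: noise_def abs_le_iff)

lemma Z_rec_noise:
  "\<omega> \<in> space M \<Longrightarrow>
    Z (Suc n) \<omega> = (1 - r n) *\<^sub>R Z n \<omega> + r n *\<^sub>R (P *v Z n \<omega>) + r n *\<^sub>R noise n \<omega>"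
  by (simp add: Z_rec noise_def algebra_simps)

section \<open>The filtration and adaptedness\<close>

lemma space_F [simp]: "space (F n) = space M"
  unfolding history_def by (rule space_measure_of) auto

lemma sets_F: "sets (F n) = sigma_sets (space M)
     ({{\<omega> \<in> space M. Z 0 \<omega> $ l \<in> B} | l B. B \<in> sets borel} \<union>
      {{\<omega> \<in> space M. X k \<omega> $ l \<in> B} | k l B. 1 \<le> k \<and> k \<le> n \<and> B \<in> sets borel})"
  unfolding history_def by (rule sets_measure_of) auto

lemma subalgebra_F: "subalgebra M (F n)"
proof -
  have "{\<omega> \<in> space M. f \<omega> $ l \<in> B} \<in> sets M"
    if "f \<in> borel_measurable M" "B \<in> sets borel" for f :: "'a \<Rightarrow> real^'n" and l B
    using measurable_sets[OF component_borel_measurable[OF that(1)] that(2), of l]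
    by (simp add: vimage_def Int_def conj_commute)
  moreover have "X k \<in> borel_measurable M" if "1 \<le> k" for k
    using X_measurable[of "k - 1"] that by simp
  ultimately have "sets (F n) \<subseteq> sets M"
    unfolding sets_F using Z0_measurable by (intro sets.sigma_sets_subset) auto
  then show ?thesis by (simp add: subalgebra_def)
qed

lemma finite_measure_subalgebra_F: "finite_measure_subalgebra M (F n)"
  by (intro finite_measure_subalgebra.intro finite_measure_subalgebra_axioms.intro subalgebra_F
      finite_measure_axioms)

lemma sets_F_mono: "m \<le> n \<Longrightarrow> sets (F m) \<subseteq> sets (F n)"
  unfolding sets_F by (intro sigma_sets_mono' Un_mono subset_refl) (use le_trans in blast)

lemma X_component_F: "1 \<le> k \<Longrightarrow> k \<le> n \<Longrightarrow> (\<lambda>\<omega>. X k \<omega> $ l) \<in> borel_measurable (F n)"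
proof (rule measurableI)
  fix B :: "real set" assume "1 \<le> k" "k \<le> n" "B \<in> sets borel"
  then have "{\<omega> \<in> space M. X k \<omega> $ l \<in> B} \<in> sets (F n)"
    unfolding sets_F by (intro sigma_sets.Basic) auto
  then show "(\<lambda>\<omega>. X k \<omega> $ l) -` B \<inter> space (F n) \<in> sets (F n)"
    by (simp add: vimage_def Int_def conj_commute)
qed simp

lemma Z_component_F: "(\<lambda>\<omega>. Z n \<omega> $ l) \<in> borel_measurable (F n)"
proof (induction n)
  case 0
  show ?case
  proof (rule measurableI)
    fix B :: "real set" assume "B \<in> sets borel"
    then have "{\<omega> \<in> space M. Z 0 \<omega> $ l \<in> B} \<in> sets (F 0)"
      unfolding sets_F by (intro sigma_sets.Basic) auto
    then show "(\<lambda>\<omega>. Z 0 \<omega> $ l) -` B \<inter> space (F 0) \<in> sets (F 0)"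
      by (simp add: vimage_def Int_def conj_commute)
  qed simp
next
  case (Suc n)
  have [measurable]: "(\<lambda>\<omega>. Z n \<omega> $ l) \<in> borel_measurable (F (Suc n))"
    using Suc measurable_mono[of borel borel "F n" "F (Suc n)"] sets_F_mono[of n "Suc n"] by auto
  have [measurable]: "(\<lambda>\<omega>. X (Suc n) \<omega> $ l) \<in> borel_measurable (F (Suc n))"
    by (rule X_component_F) auto
  have "(\<lambda>\<omega>. (1 - r n) * Z n \<omega> $ l + r n * X (Suc n) \<omega> $ l) \<in> borel_measurable (F (Suc n))"
    by measurable
  then show ?case
    by (rule measurable_cong[THEN iffD2, rotated]) (simp add: Z_component_rec)
qed

lemma PZ_component_F: "(\<lambda>\<omega>. (P *v Z n \<omega>) $ l) \<in> borel_measurable (F n)"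
  unfolding matrix_vector_mult_def using Z_component_F by simp

lemma Z_inner_F: "(\<lambda>\<omega>. a \<bullet> Z n \<omega>) \<in> borel_measurable (F n)"
  unfolding inner_vec_def using Z_component_F by simp

lemma borel_measurable_from_F: "f \<in> borel_measurable (F n) \<Longrightarrow> f \<in> borel_measurable M"
  by (rule measurable_from_subalg[OF subalgebra_F])

lemma Z_inner_measurable [measurable]: "(\<lambda>\<omega>. a \<bullet> Z n \<omega>) \<in> borel_measurable M"
  by (rule borel_measurable_from_F[OF Z_inner_F])

lemma PZ_component_measurable [measurable]: "(\<lambda>\<omega>. (P *v Z n \<omega>) $ l) \<in> borel_measurable M"
  by (rule borel_measurable_from_F[OF PZ_component_F])

lemma X_component_measurable [measurable]: "(\<lambda>\<omega>. X (Suc n) \<omega> $ l) \<in> borel_measurable M"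
  by (rule component_borel_measurable[OF X_measurable])

lemma noise_component_measurable [measurable]: "(\<lambda>\<omega>. noise n \<omega> $ l) \<in> borel_measurable M"
  unfolding noise_def by simp

section \<open>First and second moments of the noise\<close>

lemma integrable_bounded:
  fixes f :: "'a \<Rightarrow> real"
  assumes "f \<in> borel_measurable M" "\<And>\<omega>. \<omega> \<in> space M \<Longrightarrow> \<bar>f \<omega>\<bar> \<le> B"
  shows "integrable M f"
  using assms by (intro integrable_const_bound[of _ B]) auto

text \<open>The martingale difference property in integrated form: a component of
  \<open>X (Suc n)\<close> is the indicator of an event with conditional probability
  \<open>(P *v Z n \<omega>) $ l\<close>, and \<open>f\<close> may be moved into the conditional
  expectation.\<close>

lemma noise_orthogonal:
  assumes f: "f \<in> borel_measurable (F n)" and bound: "\<And>\<omega>. \<omega> \<in> space M \<Longrightarrow> \<bar>f \<omega>\<bar> \<le> B"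
  shows "expectation (\<lambda>\<omega>. f \<omega> * noise n \<omega> $ l) = 0"
proof -
  interpret F: finite_measure_subalgebra M "F n" by (rule finite_measure_subalgebra_F)
  define S where "S = {\<omega> \<in> space M. X (Suc n) \<omega> $ l = 1}"
  have S [measurable]: "S \<in> sets M" unfolding S_def by measurable
  note f [THEN borel_measurable_from_F, measurable]
  have B0: "0 \<le> B" if "\<omega> \<in> space M" for \<omega> using bound[OF that] by simp
  have int: "integrable M (\<lambda>\<omega>. f \<omega> * g \<omega>)"
    if [measurable]: "g \<in> borel_measurable M" and "\<And>\<omega>. \<omega> \<in> space M \<Longrightarrow> 0 \<le> g \<omega> \<and> g \<omega> \<le> 1" for g
  proof (rule integrable_bounded)
    show "\<bar>f \<omega> * g \<omega>\<bar> \<le> B * 1" if "\<omega> \<in> space M" for \<omega>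
      unfolding abs_mult using bound that \<open>\<And>\<omega>. \<omega> \<in> space M \<Longrightarrow> 0 \<le> g \<omega> \<and> g \<omega> \<le> 1\<close>[OF that] B0
      by (intro mult_mono) auto
  qed simp
  have "expectation (\<lambda>\<omega>. f \<omega> * X (Suc n) \<omega> $ l) = expectation (\<lambda>\<omega>. f \<omega> * indicator S \<omega>)"
    using X_range[of _ n l] by (intro Bochner_Integration.integral_cong) (auto simp: S_def indicator_def)
  also have "\<dots> = expectation (\<lambda>\<omega>. f \<omega> * real_cond_exp M (F n) (indicator S) \<omega>)"
    by (rule F.real_cond_exp_intg(2)[symmetric]) (auto intro!: int f)
  also have "\<dots> = expectation (\<lambda>\<omega>. f \<omega> * (P *v Z n \<omega>) $ l)"
  proof (rule integral_cong_AE)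
    show "AE \<omega> in M. f \<omega> * real_cond_exp M (F n) (indicator S) \<omega> = f \<omega> * (P *v Z n \<omega>) $ l"
      using X_prob[of n l] unfolding S_def by eventually_elim simp
  qed simp_all
  finally have "expectation (\<lambda>\<omega>. f \<omega> * X (Suc n) \<omega> $ l) = expectation (\<lambda>\<omega>. f \<omega> * (P *v Z n \<omega>) $ l)" .
  moreover have "expectation (\<lambda>\<omega>. f \<omega> * noise n \<omega> $ l) =
      expectation (\<lambda>\<omega>. f \<omega> * X (Suc n) \<omega> $ l) - expectation (\<lambda>\<omega>. f \<omega> * (P *v Z n \<omega>) $ l)"
    by (subst Bochner_Integration.integral_diff[symmetric])
       (auto simp: noise_def algebra_simps intro!: int X_01 PZ_01)
  ultimately show ?thesis by simp
qed

text \<open>Conditional independence gives the product \<open>X i * X j\<close> the same expectation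
  as the product of the two conditional means. The mixed terms, a conditional mean times a noise
  component, vanish by orthogonality.\<close>

lemma noise_uncorrelated:
  assumes "i \<noteq> j"
  shows "expectation (\<lambda>\<omega>. noise n \<omega> $ i * noise n \<omega> $ j) = 0"
proof -
  interpret F: finite_measure_subalgebra M "F n" by (rule finite_measure_subalgebra_F)
  \<comment> \<open>Membership in \<open>{1}\<close> instead of an equation, so that conditional
    independence applies with the constant family of Borel sets \<open>{1}\<close>.\<close>
  define S where "S = (\<lambda>J. {\<omega> \<in> space M. \<forall>l\<in>J. X (Suc n) \<omega> $ l \<in> {1}})"
  have S [measurable]: "finite J \<Longrightarrow> S J \<in> sets M" for J unfolding S_def by measurable
  have prod_01: "0 \<le> a * b \<and> a * b \<le> 1" if "0 \<le> a \<and> a \<le> 1" "0 \<le> b \<and> b \<le> 1" for a b :: real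
    using that mult_mono[of a 1 b 1] by auto
  have "AE \<omega> in M. real_cond_exp M (F n) (indicator (S {i, j})) \<omega> =
      (\<Prod>l\<in>{i, j}. real_cond_exp M (F n) (indicator {\<omega> \<in> space M. X (Suc n) \<omega> $ l \<in> {1}}) \<omega>)"
    using X_indep[of n] unfolding cond_indep_vars_def S_def
    by (elim allE[of _ "{i, j}"] allE[of _ "\<lambda>_. {1}"]) auto
  then have cond: "AE \<omega> in M. real_cond_exp M (F n) (indicator (S {i, j})) \<omega> =
      (P *v Z n \<omega>) $ i * (P *v Z n \<omega>) $ j"
    using X_prob[of n i] X_prob[of n j] by eventually_elim (use assms in simp)
  have "expectation (\<lambda>\<omega>. X (Suc n) \<omega> $ i * X (Suc n) \<omega> $ j) = expectation (indicator (S {i, j}))"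
    using X_range[of _ n i] X_range[of _ n j]
    by (intro Bochner_Integration.integral_cong) (auto simp: S_def indicator_def)
  also have "\<dots> = expectation (real_cond_exp M (F n) (indicator (S {i, j})))"
    using S[of "{i, j}"]
    by (intro F.real_cond_exp_int(2)[symmetric] integrable_bounded[of _ 1]) (auto simp: indicator_def)
  also have "\<dots> = expectation (\<lambda>\<omega>. (P *v Z n \<omega>) $ i * (P *v Z n \<omega>) $ j)"
    using cond by (intro integral_cong_AE) auto
  finally have XX: "expectation (\<lambda>\<omega>. X (Suc n) \<omega> $ i * X (Suc n) \<omega> $ j) =
      expectation (\<lambda>\<omega>. (P *v Z n \<omega>) $ i * (P *v Z n \<omega>) $ j)" .
  have orth: "expectation (\<lambda>\<omega>. (P *v Z n \<omega>) $ k * noise n \<omega> $ l) = 0" for k l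
    using PZ_01 by (intro noise_orthogonal[of _ _ 1] PZ_component_F) auto
  have int: "integrable M (\<lambda>\<omega>. f \<omega> * g \<omega>)"
    if [measurable]: "f \<in> borel_measurable M" "g \<in> borel_measurable M"
      and "\<And>\<omega>. \<omega> \<in> space M \<Longrightarrow> \<bar>f \<omega>\<bar> \<le> 1" "\<And>\<omega>. \<omega> \<in> space M \<Longrightarrow> \<bar>g \<omega>\<bar> \<le> 1" for f g :: "'a \<Rightarrow> real"
    using that by (intro integrable_bounded[of _ 1]) (auto simp: abs_mult intro!: mult_le_one)
  have abs1: "\<omega> \<in> space M \<Longrightarrow> \<bar>X (Suc n) \<omega> $ l\<bar> \<le> 1" "\<omega> \<in> space M \<Longrightarrow> \<bar>(P *v Z n \<omega>) $ l\<bar> \<le> 1" for \<omega> l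
    using X_01[of \<omega> n l] PZ_01[of \<omega> n l] by auto
  have "expectation (\<lambda>\<omega>. noise n \<omega> $ i * noise n \<omega> $ j) =
      expectation (\<lambda>\<omega>. X (Suc n) \<omega> $ i * X (Suc n) \<omega> $ j - (P *v Z n \<omega>) $ i * (P *v Z n \<omega>) $ j
        - (P *v Z n \<omega>) $ i * noise n \<omega> $ j - (P *v Z n \<omega>) $ j * noise n \<omega> $ i)"
    by (intro Bochner_Integration.integral_cong) (auto simp: noise_def algebra_simps)
  also have "\<dots> = expectation (\<lambda>\<omega>. X (Suc n) \<omega> $ i * X (Suc n) \<omega> $ j)
      - expectation (\<lambda>\<omega>. (P *v Z n \<omega>) $ i * (P *v Z n \<omega>) $ j)
      - expectation (\<lambda>\<omega>. (P *v Z n \<omega>) $ i * noise n \<omega> $ j)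
      - expectation (\<lambda>\<omega>. (P *v Z n \<omega>) $ j * noise n \<omega> $ i)"
    by (subst Bochner_Integration.integral_diff
        | intro Bochner_Integration.integrable_diff int abs1 noise_abs_le refl
          noise_component_measurable X_component_measurable PZ_component_measurable | assumption)+
  finally show ?thesis by (simp add: XX orth)
qed

text \<open>Pythagoras: \<open>f\<close> is orthogonal to the noise, and distinct noise components
  are orthogonal to each other.\<close>

lemma second_moment_noise:
  fixes a :: "real^'n"
  assumes f: "f \<in> borel_measurable (F n)" and bound: "\<And>\<omega>. \<omega> \<in> space M \<Longrightarrow> \<bar>f \<omega>\<bar> \<le> B"
  shows "expectation (\<lambda>\<omega>. (f \<omega> + a \<bullet> noise n \<omega>)\<^sup>2) =
    expectation (\<lambda>\<omega>. (f \<omega>)\<^sup>2) + (\<Sum>i\<in>UNIV. (a $ i)\<^sup>2 * expectation (\<lambda>\<omega>. (noise n \<omega> $ i)\<^sup>2))"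
proof -
  note f [THEN borel_measurable_from_F, measurable]
  have B0: "0 \<le> B" if "\<omega> \<in> space M" for \<omega> using bound[OF that] by simp
  have if2: "integrable M (\<lambda>\<omega>. (f \<omega>)\<^sup>2)"
    using bound B0 by (intro integrable_bounded[of _ "B\<^sup>2"]) (auto simp: abs_le_square_iff[symmetric])
  have ifn: "integrable M (\<lambda>\<omega>. f \<omega> * noise n \<omega> $ i)" for i
    using mult_mono[OF bound noise_abs_le _ abs_ge_zero, of _ _ n i] B0
    by (intro integrable_bounded[of _ B]) (auto simp: abs_mult)
  have inn: "integrable M (\<lambda>\<omega>. noise n \<omega> $ i * noise n \<omega> $ j)" for i j
    using mult_mono[OF noise_abs_le noise_abs_le _ abs_ge_zero, of _ _ n i n j]
    by (intro integrable_bounded[of _ 1]) (auto simp: abs_mult)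
  have "expectation (\<lambda>\<omega>. (f \<omega> + a \<bullet> noise n \<omega>)\<^sup>2) = expectation (\<lambda>\<omega>. (f \<omega>)\<^sup>2
      + (\<Sum>i\<in>UNIV. 2 * a $ i * (f \<omega> * noise n \<omega> $ i))
      + (\<Sum>i\<in>UNIV. \<Sum>j\<in>UNIV. a $ i * a $ j * (noise n \<omega> $ i * noise n \<omega> $ j)))"
    by (intro Bochner_Integration.integral_cong refl)
       (simp add: inner_vec_def power2_eq_square algebra_simps sum_distrib_left sum_distrib_right)
  also have "\<dots> = expectation (\<lambda>\<omega>. (f \<omega>)\<^sup>2)
      + (\<Sum>i\<in>UNIV. 2 * a $ i * expectation (\<lambda>\<omega>. f \<omega> * noise n \<omega> $ i))
      + (\<Sum>i\<in>UNIV. \<Sum>j\<in>UNIV. a $ i * a $ j * expectation (\<lambda>\<omega>. noise n \<omega> $ i * noise n \<omega> $ j))"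
    using if2 ifn inn by simp
  also have "(\<Sum>i\<in>UNIV. \<Sum>j\<in>UNIV. a $ i * a $ j * expectation (\<lambda>\<omega>. noise n \<omega> $ i * noise n \<omega> $ j))
      = (\<Sum>i\<in>UNIV. \<Sum>j\<in>UNIV. if i = j then (a $ i)\<^sup>2 * expectation (\<lambda>\<omega>. (noise n \<omega> $ i)\<^sup>2) else 0)"
    by (intro sum.cong refl) (auto simp: noise_uncorrelated power2_eq_square)
  finally show ?thesis
    using noise_orthogonal[OF f bound] by simp
qed

end

text \<open>The sum of the series has finite integral, so the series converges almost everywhere and
  its terms tend to 0.\<close>

lemma AE_tendsto_0_of_summable_integrals:
  fixes f :: "nat \<Rightarrow> 'a \<Rightarrow> real"
  assumes int: "\<And>n. integrable M (f n)" and nonneg: "\<And>n \<omega>. 0 \<le> f n \<omega>"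
    and sum: "summable (\<lambda>n. integral\<^sup>L M (f n))"
  shows "AE \<omega> in M. (\<lambda>n. f n \<omega>) \<longlonglongrightarrow> 0"
proof -
  have [measurable]: "f n \<in> borel_measurable M" for n using int by auto
  have "(\<integral>\<^sup>+ \<omega>. (\<Sum>n. ennreal (f n \<omega>)) \<partial>M) = (\<Sum>n. ennreal (integral\<^sup>L M (f n)))"
    using int nonneg by (subst nn_integral_suminf) (auto simp: nn_integral_eq_integral)
  also have "\<dots> \<noteq> \<infinity>"
    using ennreal_suminf_neq_top[OF sum Bochner_Integration.integral_nonneg, OF nonneg]
    unfolding infinity_ennreal_def .
  finally have "AE \<omega> in M. (\<Sum>n. ennreal (f n \<omega>)) \<noteq> \<infinity>"
    by (intro nn_integral_PInf_AE) auto
  then show ?thesis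
  proof eventually_elim
    case (elim \<omega>)
    then have "summable (\<lambda>n. f n \<omega>)" using nonneg by (intro summable_suminf_not_top) auto
    then show ?case by (rule summable_LIMSEQ_zero)
  qed
qed

section \<open>Almost sure decay of the scaled noise\<close>

context reinforced_process
begin

text \<open>Since \<open>v\<close> is a left eigenvector, \<open>v \<bullet> Z n\<close> changes
  only by \<open>r n\<close> times \<open>v \<bullet> noise n\<close>. Its second moments stay
  bounded, so their increments, positive combinations of the \<open>s n i\<close>, are
  summable.\<close>

lemma noise_vanishes:
  assumes v: "\<And>i. v $ i > 0" and eig: "v v* P = v"
  shows "AE \<omega> in M. \<forall>i. (\<lambda>n. r n * noise n \<omega> $ i) \<longlonglongrightarrow> 0"
proof -
  define B where "B = (\<Sum>i\<in>UNIV. v $ i)"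
  define m where "m = (\<lambda>n. expectation (\<lambda>\<omega>. (v \<bullet> Z n \<omega>)\<^sup>2))"
  define s where "s = (\<lambda>n i. expectation (\<lambda>\<omega>. (r n * noise n \<omega> $ i)\<^sup>2))"
  have vZ: "0 \<le> v \<bullet> Z n \<omega> \<and> v \<bullet> Z n \<omega> \<le> B" if "\<omega> \<in> space M" for n \<omega>
    using Z_01[OF that] v
    by (auto simp: inner_vec_def B_def less_imp_le mult_left_le intro!: sum_nonneg sum_mono mult_nonneg_nonneg)
  have m_bound: "0 \<le> m n \<and> m n \<le> B\<^sup>2" for n
  proof -
    have "m n \<le> expectation (\<lambda>\<omega>. B\<^sup>2)"
      unfolding m_def using vZ[of _ n]
      by (intro integral_mono integrable_bounded[of _ "B\<^sup>2"]) (auto intro: power_mono)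
    then show ?thesis by (simp add: m_def prob_space)
  qed
  have s_nonneg: "0 \<le> s n i" for n i by (simp add: s_def)
  have step: "m (Suc n) = m n + (\<Sum>i\<in>UNIV. (v $ i)\<^sup>2 * s n i)" for n
  proof -
    have "v \<bullet> Z (Suc n) \<omega> = v \<bullet> Z n \<omega> + (r n *\<^sub>R v) \<bullet> noise n \<omega>" if "\<omega> \<in> space M" for \<omega>
    proof -
      have "v \<bullet> (P *v Z n \<omega>) = v \<bullet> Z n \<omega>"
        by (metis dot_lmul_matrix eig)
      then show ?thesis
        by (simp add: Z_rec_noise[OF that] inner_add_right algebra_simps)
    qed
    then have "m (Suc n) = expectation (\<lambda>\<omega>. (v \<bullet> Z n \<omega> + (r n *\<^sub>R v) \<bullet> noise n \<omega>)\<^sup>2)"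
      unfolding m_def by (intro Bochner_Integration.integral_cong) auto
    also have "\<dots> = m n + (\<Sum>i\<in>UNIV. ((r n *\<^sub>R v) $ i)\<^sup>2 * expectation (\<lambda>\<omega>. (noise n \<omega> $ i)\<^sup>2))"
      unfolding m_def using vZ by (intro second_moment_noise[of _ n B] Z_inner_F) auto
    finally show ?thesis by (simp add: s_def power_mult_distrib mult_ac)
  qed
  have partial: "(\<Sum>k<n. \<Sum>i\<in>UNIV. (v $ i)\<^sup>2 * s k i) = m n - m 0" for n
    by (induction n) (simp_all add: step)
  have "summable (\<lambda>n. \<Sum>i\<in>UNIV. (v $ i)\<^sup>2 * s n i)"
  proof (rule summableI_nonneg_bounded)
    show "(\<Sum>k<n. \<Sum>i\<in>UNIV. (v $ i)\<^sup>2 * s k i) \<le> B\<^sup>2" for n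
      unfolding partial using m_bound[of n] m_bound[of 0] by linarith
  qed (intro sum_nonneg mult_nonneg_nonneg s_nonneg zero_le_power2)
  then have weighted: "summable (\<lambda>n. (v $ i)\<^sup>2 * s n i)" for i
  proof (rule summable_comparison_test'[where N = 0])
    show "norm ((v $ i)\<^sup>2 * s n i) \<le> (\<Sum>i\<in>UNIV. (v $ i)\<^sup>2 * s n i)" for n
      using member_le_sum[of i UNIV "\<lambda>i. (v $ i)\<^sup>2 * s n i"] s_nonneg by simp
  qed
  have sum: "summable (\<lambda>n. s n i)" for i
    using weighted[of i] v[of i] by simp
  have "AE \<omega> in M. (\<lambda>n. (r n * noise n \<omega> $ i)\<^sup>2) \<longlonglongrightarrow> 0" for i
  proof (rule AE_tendsto_0_of_summable_integrals)
    show "integrable M (\<lambda>\<omega>. (r n * noise n \<omega> $ i)\<^sup>2)" for n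
    proof (rule integrable_bounded[of _ 1])
      show "\<bar>(r n * noise n \<omega> $ i)\<^sup>2\<bar> \<le> 1" if "\<omega> \<in> space M" for \<omega>
        using noise_abs_le[OF that, of n i] r_range[of n]
        by (simp add: abs_square_le_1 abs_mult mult_le_one)
    qed simp
    show "summable (\<lambda>n. expectation (\<lambda>\<omega>. (r n * noise n \<omega> $ i)\<^sup>2))"
      using sum[of i] by (simp add: s_def)
  qed simp
  then have "AE \<omega> in M. \<forall>i. (\<lambda>n. (r n * noise n \<omega> $ i)\<^sup>2) \<longlonglongrightarrow> 0"
    by (simp add: AE_all_countable)
  then show ?thesis
    by eventually_elim simp
qed

end

section \<open>Counting the classes near the barriers\<close>

lemma card_Collect_eq_sum_of_bool:
  "real (card {h. h < d \<and> Q h}) = (\<Sum>h<(d::nat). of_bool (Q h))"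
proof -
  have "{h. h < d \<and> Q h} = {..<d} \<inter> {h. Q h}" by auto
  then show ?thesis by simp
qed

lemma barrier_counts_tendsto:
  fixes y :: "nat \<Rightarrow> nat \<Rightarrow> real"
  assumes y01: "\<And>n h. h < d \<Longrightarrow> 0 \<le> y n h \<and> y n h \<le> 1"
    and barrier: "\<And>h. h < d \<Longrightarrow> (\<lambda>n. y n h * (1 - y n h)) \<longlonglongrightarrow> 0"
    and \<epsilon>: "0 < \<epsilon>" "\<epsilon> < 1 / 2"
  shows "(\<lambda>n. real (card {h. h < d \<and> 1 - \<epsilon> \<le> y n h}) - (\<Sum>h<d. y n h)) \<longlonglongrightarrow> 0"
    and "(\<lambda>n. real (card {h. h < d \<and> y n h \<le> \<epsilon>}) - (real d - (\<Sum>h<d. y n h))) \<longlonglongrightarrow> 0"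
proof -
  have bound: "(\<lambda>n. y n h * (1 - y n h) / \<epsilon>) \<longlonglongrightarrow> 0" if "h < d" for h
    using tendsto_divide[OF barrier[OF that] tendsto_const[of \<epsilon>]] \<epsilon> by simp
  have "(\<lambda>n. \<Sum>h<d. of_bool (1 - \<epsilon> \<le> y n h) - y n h) \<longlonglongrightarrow> (\<Sum>h<d. 0)"
    using threshold_indicator_diff_le(1)[OF \<epsilon>] y01
    by (intro tendsto_sum Lim_null_comparison[OF _ bound]) auto
  then show "(\<lambda>n. real (card {h. h < d \<and> 1 - \<epsilon> \<le> y n h}) - (\<Sum>h<d. y n h)) \<longlonglongrightarrow> 0"
    unfolding card_Collect_eq_sum_of_bool by (simp add: sum_subtractf)
  have "(\<lambda>n. \<Sum>h<d. of_bool (y n h \<le> \<epsilon>) - (1 - y n h)) \<longlonglongrightarrow> (\<Sum>h<d. 0)"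
    using threshold_indicator_diff_le(2)[OF \<epsilon>] y01
    by (intro tendsto_sum Lim_null_comparison[OF _ bound]) auto
  then show "(\<lambda>n. real (card {h. h < d \<and> y n h \<le> \<epsilon>}) - (real d - (\<Sum>h<d. y n h))) \<longlonglongrightarrow> 0"
    unfolding card_Collect_eq_sum_of_bool by (simp add: sum_subtractf)
qed

text \<open>Integers at distance less than 1 coincide.\<close>

lemma nat_sequence_eventually_constant:
  fixes k :: "nat \<Rightarrow> nat"
  assumes "(\<lambda>n. real (k (Suc n)) - real (k n)) \<longlonglongrightarrow> 0"
  shows "\<exists>N. \<forall>n\<ge>N. k n = k N"
proof -
  obtain N where N: "\<And>n. n \<ge> N \<Longrightarrow> \<bar>real (k (Suc n)) - real (k n)\<bar> < 1"
    using LIMSEQ_D[OF assms, of 1] by auto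
  have "k n = k N" if "n \<ge> N" for n
    using that
  proof (induction n rule: dec_induct)
    case (step n)
    then show ?case using N[of n] by linarith
  qed simp
  then show ?thesis by (intro exI[of _ N] allI impI)
qed

text \<open>The number of classes above a threshold tracks the sum of the \<open>y n h\<close>, so
  its increments vanish as well, and being an integer it is eventually constant.\<close>

lemma barrier_sum_converges_to_nat:
  fixes y :: "nat \<Rightarrow> nat \<Rightarrow> real"
  assumes y01: "\<And>n h. h < d \<Longrightarrow> 0 \<le> y n h \<and> y n h \<le> 1"
    and barrier: "\<And>h. h < d \<Longrightarrow> (\<lambda>n. y n h * (1 - y n h)) \<longlonglongrightarrow> 0"
    and incr: "(\<lambda>n. (\<Sum>h<d. y (Suc n) h) - (\<Sum>h<d. y n h)) \<longlonglongrightarrow> 0"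
  shows "\<exists>k\<le>d. (\<lambda>n. \<Sum>h<d. y n h) \<longlonglongrightarrow> real k"
proof -
  \<comment> \<open>The value 1/4 is arbitrary in the interval from 0 to 1/2.\<close>
  define k where "k = (\<lambda>n. card {h. h < d \<and> 1 - 1 / 4 \<le> y n h})"
  have ks: "(\<lambda>n. real (k n) - (\<Sum>h<d. y n h)) \<longlonglongrightarrow> 0"
    unfolding k_def by (rule barrier_counts_tendsto(1)[OF y01 barrier]) auto
  have "(\<lambda>n. (real (k (Suc n)) - (\<Sum>h<d. y (Suc n) h)) - (real (k n) - (\<Sum>h<d. y n h))
      + ((\<Sum>h<d. y (Suc n) h) - (\<Sum>h<d. y n h))) \<longlonglongrightarrow> 0 - 0 + 0"
    by (intro tendsto_add tendsto_diff LIMSEQ_Suc[OF ks] ks incr)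
  then have "(\<lambda>n. real (k (Suc n)) - real (k n)) \<longlonglongrightarrow> 0" by (simp add: algebra_simps)
  then obtain N where N: "\<And>n. n \<ge> N \<Longrightarrow> k n = k N"
    using nat_sequence_eventually_constant by blast
  have "(\<lambda>n. real (k n)) \<longlonglongrightarrow> real (k N)"
    by (intro tendsto_eventually eventually_sequentiallyI[of N] arg_cong[of _ _ real] N)
  from tendsto_diff[OF this ks] have "(\<lambda>n. \<Sum>h<d. y n h) \<longlonglongrightarrow> real (k N)" by simp
  moreover have "k N \<le> d"
    unfolding k_def by (rule order_trans[OF card_mono[of "{..<d}"]]) auto
  ultimately show ?thesis by blast
qed

section \<open>Class means\<close>

text \<open>The linear functional behind the class mean, so that the action of a matrix can be moved
  onto it by transposition.\<close>

definition class_vector :: "real^'n \<Rightarrow> ('n \<Rightarrow> nat) \<Rightarrow> nat \<Rightarrow> real^'n" where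
  "class_vector v c h = (\<chi> i. if c i = h then v $ i / (\<Sum>j\<in>{j. c j = h}. v $ j) else 0)"

lemma class_mean_eq_inner: "class_mean v c z h = class_vector v c h \<bullet> z"
  unfolding class_mean_def class_vector_def inner_vec_def
  by (rule sum.mono_neutral_cong_left) auto

lemma sum_cyclic_shift:
  fixes g :: "nat \<Rightarrow> 'b::comm_monoid_add"
  assumes "d > 0"
  shows "(\<Sum>h<d. g (Suc h mod d)) = (\<Sum>h<d. g h)"
proof -
  obtain e where d: "d = Suc e" using assms gr0_implies_Suc by blast
  have "(\<Sum>h<e. g (Suc h mod Suc e)) = (\<Sum>h<e. g (Suc h))" by (intro sum.cong) auto
  moreover have "(\<Sum>h<Suc e. g h) = g 0 + (\<Sum>h<e. g (Suc h))" by (rule sum.lessThan_Suc_shift)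
  ultimately show ?thesis by (simp add: d add.commute del: sum.lessThan_Suc) (simp add: add.commute)
qed

lemma Suc_mod_inj: "a < d \<Longrightarrow> b < d \<Longrightarrow> Suc a mod d = Suc b mod d \<Longrightarrow> a = b"
  by (auto simp: mod_Suc split: if_splits)

lemma left_eigenvector_component:
  fixes v :: "real^'n"
  assumes "v v* A = w"
  shows "w $ j = (\<Sum>i\<in>UNIV. v $ i * A $ i $ j)"
  unfolding assms[symmetric] by (simp add: vector_matrix_mult_def mult.commute)

lemma cyclic_numbering_less:
  "cyclic_numbering A c \<Longrightarrow> c i < period A"
  unfolding cyclic_numbering_def by (metis atLeastLessThan_iff rangeI)

lemma cyclic_numbering_zero:
  "cyclic_numbering A c \<Longrightarrow> c j \<noteq> Suc (c i) mod period A \<Longrightarrow> A $ i $ j = 0"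
  by (auto simp: cyclic_numbering_def)

text \<open>By stationarity the mass of the next class is the mass flowing into it, and this is
  exactly the mass of class \<open>h\<close>, all of which moves there in one step.\<close>

lemma class_mass_shift:
  fixes v :: "real^'n"
  assumes row: "\<And>i. (\<Sum>j\<in>UNIV. A $ i $ j) = 1" and c: "cyclic_numbering A c"
    and eig: "v v* A = v" and h: "h < period A"
  shows "(\<Sum>j\<in>{j. c j = Suc h mod period A}. v $ j) = (\<Sum>i\<in>{i. c i = h}. v $ i)"
proof -
  let ?h = "Suc h mod period A"
  have inner: "(\<Sum>j\<in>{j. c j = ?h}. A $ i $ j) = (if c i = h then 1 else 0)" for i
  proof (cases "c i = h")
    case True
    have "(\<Sum>j\<in>{j. c j = ?h}. A $ i $ j) = (\<Sum>j\<in>UNIV. A $ i $ j)"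
      using cyclic_numbering_zero[OF c, of _ i] True by (intro sum.mono_neutral_left) auto
    then show ?thesis using row True by simp
  next
    case False
    then have "?h \<noteq> Suc (c i) mod period A"
      using Suc_mod_inj[OF cyclic_numbering_less[OF c] h] by metis
    then show ?thesis using cyclic_numbering_zero[OF c, of _ i] False by simp
  qed
  have "(\<Sum>j\<in>{j. c j = ?h}. v $ j) = (\<Sum>j\<in>{j. c j = ?h}. \<Sum>i\<in>UNIV. v $ i * A $ i $ j)"
    by (intro sum.cong refl left_eigenvector_component[OF eig])
  also have "\<dots> = (\<Sum>i\<in>UNIV. v $ i * (\<Sum>j\<in>{j. c j = ?h}. A $ i $ j))"
    by (subst sum.swap) (simp add: sum_distrib_left)
  also have "\<dots> = (\<Sum>i\<in>{i. c i = h}. v $ i)"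
    unfolding inner by (rule sum.mono_neutral_cong_right) auto
  finally show ?thesis .
qed

text \<open>Multiplying the functional of class \<open>h\<close> by \<open>A\<close> from the right
  gives that of the next class: stationarity identifies the entries, and equal class masses identify
  the normalizations.\<close>

lemma class_mean_shift:
  fixes v :: "real^'n"
  assumes row: "\<And>i. (\<Sum>j\<in>UNIV. A $ i $ j) = 1" and c: "cyclic_numbering A c"
    and eig: "v v* A = v" and h: "h < period A"
  shows "class_mean v c (A *v z) h = class_mean v c z (Suc h mod period A)"
proof -
  let ?h = "Suc h mod period A"
  let ?V = "\<Sum>i\<in>{i. c i = h}. v $ i"
  have "(class_vector v c h v* A) $ j = class_vector v c ?h $ j" for j
  proof (cases "c j = ?h")
    case True
    have zero: "A $ i $ j = 0" if "c i \<noteq> h" for i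
    proof -
      have "c j \<noteq> Suc (c i) mod period A"
        using True that Suc_mod_inj[OF cyclic_numbering_less[OF c] h] by metis
      then show ?thesis using cyclic_numbering_zero[OF c] by simp
    qed
    have "(class_vector v c h v* A) $ j = (\<Sum>i\<in>UNIV. v $ i * A $ i $ j / ?V)"
      unfolding left_eigenvector_component[OF refl] class_vector_def
      by (intro sum.cong) (auto simp: zero)
    also have "\<dots> = v $ j / ?V"
      unfolding left_eigenvector_component[OF eig, of j] sum_divide_distrib ..
    also have "\<dots> = class_vector v c ?h $ j"
      using True class_mass_shift[OF row c eig h] by (simp add: class_vector_def)
    finally show ?thesis .
  next
    case False
    have "(class_vector v c h v* A) $ j = (\<Sum>i\<in>(UNIV::'n set). 0)"
      unfolding left_eigenvector_component[OF refl] class_vector_def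
      using False cyclic_numbering_zero[OF c, of j] by (intro sum.cong) auto
    then show ?thesis using False by (simp add: class_vector_def)
  qed
  then have "class_vector v c h v* A = class_vector v c ?h" by (simp add: vec_eq_iff)
  then show ?thesis
    unfolding class_mean_eq_inner by (metis dot_lmul_matrix)
qed

lemma class_mean_01:
  fixes v :: "real^'n"
  assumes v: "\<And>i. v $ i > 0" and h: "h \<in> range c" and z: "\<And>i. 0 \<le> z $ i \<and> z $ i \<le> 1"
  shows "0 \<le> class_mean v c z h \<and> class_mean v c z h \<le> 1"
proof -
  have V: "0 < (\<Sum>j\<in>{j. c j = h}. v $ j)" using v h by (intro sum_pos) auto
  have "class_mean v c z h \<le> (\<Sum>i\<in>{i. c i = h}. v $ i / (\<Sum>j\<in>{j. c j = h}. v $ j) * 1)"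
    unfolding class_mean_def using v V z
    by (intro sum_mono mult_left_mono) (auto simp: less_imp_le)
  also have "\<dots> = 1" using V by (simp add: sum_divide_distrib[symmetric])
  finally show ?thesis
    unfolding class_mean_def using v V z
    by (auto simp: less_imp_le intro!: sum_nonneg mult_nonneg_nonneg divide_nonneg_pos)
qed

lemma class_mean_tendsto_0:
  fixes w :: "nat \<Rightarrow> real^'n"
  assumes "\<And>i. (\<lambda>n. w n $ i) \<longlonglongrightarrow> 0"
  shows "(\<lambda>n. class_mean v c (w n) h) \<longlonglongrightarrow> 0"
  unfolding class_mean_def by (intro tendsto_null_sum tendsto_mult_right_zero assms)

text \<open>\<open>b\<close> is an extreme point of the unit interval, so each point of positive
  weight equals \<open>b\<close>; the weight of \<open>x\<close> is positive because
  \<open>r < 1\<close>.\<close>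

lemma convex_combination_extreme:
  fixes x y b r :: real
  assumes "0 \<le> x \<and> x \<le> 1" "0 \<le> y \<and> y \<le> 1" "0 \<le> r \<and> r < 1" "b \<in> {0, 1}"
    and eq: "(1 - r) * x + r * y = b"
  shows "x = b" and "r > 0 \<Longrightarrow> y = b"
proof -
  have nn: "0 \<le> (1 - r) * x" "0 \<le> r * y" "0 \<le> (1 - r) * (1 - x)" "0 \<le> r * (1 - y)"
    using assms by auto
  have eq': "(1 - r) * (1 - x) + r * (1 - y) = 1 - b" using eq by (simp add: algebra_simps)
  have "b = 0 \<or> b = 1" using assms by auto
  then have both: "x = b \<and> (r > 0 \<longrightarrow> y = b)"
  proof
    assume "b = 0"
    then have "(1 - r) * x = 0 \<and> r * y = 0" using nn eq by linarith
    with \<open>b = 0\<close> assms show ?thesis by auto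
  next
    assume "b = 1"
    then have "(1 - r) * (1 - x) = 0 \<and> r * (1 - y) = 0" using nn eq' by linarith
    with \<open>b = 1\<close> assms show ?thesis by auto
  qed
  show "x = b" and "r > 0 \<Longrightarrow> y = b" using both by auto
qed

section \<open>Asymptotics of the cyclic classes\<close>

context reinforced_process
begin

text \<open>Testing against the sign of \<open>f\<close>, which is orthogonal to the noise.\<close>

lemma expectation_abs_le_add_noise:
  assumes f: "f \<in> borel_measurable (F n)" and bound: "\<And>\<omega>. \<omega> \<in> space M \<Longrightarrow> \<bar>f \<omega>\<bar> \<le> B"
  shows "expectation (\<lambda>\<omega>. \<bar>f \<omega>\<bar>) \<le> expectation (\<lambda>\<omega>. \<bar>f \<omega> + a \<bullet> noise n \<omega>\<bar>)"
proof -
  note f [THEN borel_measurable_from_F, measurable]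
  have sgn_F: "(\<lambda>\<omega>. sgn (f \<omega>)) \<in> borel_measurable (F n)" using f by measurable
  note sgn_F [THEN borel_measurable_from_F, measurable]
  have int_f: "integrable M f" using bound by (intro integrable_bounded) auto
  have int_s: "integrable M (\<lambda>\<omega>. sgn (f \<omega>) * noise n \<omega> $ i)" for i
    using noise_abs_le[of _ n i]
    by (intro integrable_bounded[of _ 1]) (auto simp: abs_mult abs_sgn_eq)
  have int_noise: "integrable M (\<lambda>\<omega>. a \<bullet> noise n \<omega>)"
  proof -
    have "integrable M (\<lambda>\<omega>. noise n \<omega> $ i)" for i
      using noise_abs_le[of _ n i] by (intro integrable_bounded) auto
    then show ?thesis by (simp add: inner_vec_def)
  qed
  have orth: "expectation (\<lambda>\<omega>. sgn (f \<omega>) * noise n \<omega> $ i) = 0" for i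
    by (rule noise_orthogonal[OF sgn_F, of 1]) (simp add: abs_sgn_eq)
  have "expectation (\<lambda>\<omega>. \<bar>f \<omega>\<bar>) =
      expectation (\<lambda>\<omega>. \<bar>f \<omega>\<bar>) + (\<Sum>i\<in>UNIV. a $ i * expectation (\<lambda>\<omega>. sgn (f \<omega>) * noise n \<omega> $ i))"
    by (simp add: orth)
  also have "\<dots> = expectation (\<lambda>\<omega>. \<bar>f \<omega>\<bar> + (\<Sum>i\<in>UNIV. a $ i * (sgn (f \<omega>) * noise n \<omega> $ i)))"
    using int_f int_s by simp
  also have "\<dots> = expectation (\<lambda>\<omega>. sgn (f \<omega>) * (f \<omega> + a \<bullet> noise n \<omega>))"
    by (intro Bochner_Integration.integral_cong refl)
       (simp add: inner_vec_def sum_distrib_left abs_sgn algebra_simps)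
  also have "\<dots> \<le> expectation (\<lambda>\<omega>. \<bar>f \<omega> + a \<bullet> noise n \<omega>\<bar>)"
  proof (rule integral_mono)
    have "integrable M (\<lambda>\<omega>. \<bar>f \<omega>\<bar> + (\<Sum>i\<in>UNIV. a $ i * (sgn (f \<omega>) * noise n \<omega> $ i)))"
      using int_f int_s by simp
    then show "integrable M (\<lambda>\<omega>. sgn (f \<omega>) * (f \<omega> + a \<bullet> noise n \<omega>))"
      by (simp add: inner_vec_def sum_distrib_left abs_sgn algebra_simps)
    show "integrable M (\<lambda>\<omega>. \<bar>f \<omega> + a \<bullet> noise n \<omega>\<bar>)"
      using int_f int_noise by simp
    show "sgn (f \<omega>) * (f \<omega> + a \<bullet> noise n \<omega>) \<le> \<bar>f \<omega> + a \<bullet> noise n \<omega>\<bar>" for \<omega>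
      by (cases "f \<omega>" "0::real" rule: linorder_cases) (auto simp: sgn_if)
  qed
  finally show ?thesis .
qed

end

locale cyclic_reinforced_process = reinforced_process M P r Z X
  for M :: "'a measure" and P :: "real^'n^'n" and r Z X +
  fixes c :: "'n \<Rightarrow> nat" and v :: "real^'n"
  assumes P_irreducible: "irreducible_nonneg P"
    and numbering: "cyclic_numbering P c"
    and v_pos: "v $ i > 0"
    and v_eigen: "v v* P = v"
    and period_ge_2: "period P \<ge> 2"
    and r_div: "filterlim (\<lambda>n. \<Sum>k<n. r k) at_top sequentially"
    and r_summable: "summable (\<lambda>n. r n * (1 - r n))"
begin

abbreviation d :: nat where "d \<equiv> period P"

abbreviation Y :: "nat \<Rightarrow> nat \<Rightarrow> 'a \<Rightarrow> real" where "Y n h \<omega> \<equiv> class_mean v c (Z n \<omega>) h"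

text \<open>The gap between a class and the one that drives it: in the mean, class \<open>h\<close>
  moves towards class \<open>Suc h mod d\<close>.\<close>

definition D :: "nat \<Rightarrow> nat \<Rightarrow> 'a \<Rightarrow> real" where "D n h \<omega> = Y n h \<omega> - Y n (Suc h mod d) \<omega>"

lemma succ_less: "Suc h mod d < d" using period_ge_2 by simp

lemma range_c: "h < d \<longleftrightarrow> h \<in> range c"
  using numbering by (simp add: cyclic_numbering_def)

lemma Y_01: "\<omega> \<in> space M \<Longrightarrow> h < d \<Longrightarrow> 0 \<le> Y n h \<omega> \<and> Y n h \<omega> \<le> 1"
  using Z_01 range_c by (intro class_mean_01 v_pos) auto

lemma Y_F: "Y n h \<in> borel_measurable (F n)"
  unfolding class_mean_eq_inner by (rule Z_inner_F)

lemma Y_measurable [measurable]: "Y n h \<in> borel_measurable M"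
  by (rule borel_measurable_from_F[OF Y_F])

lemma Y_step:
  assumes "\<omega> \<in> space M" "h < d"
  shows "Y (Suc n) h \<omega> = (1 - r n) * Y n h \<omega> + r n * Y n (Suc h mod d) \<omega>
    + class_mean v c (r n *\<^sub>R noise n \<omega>) h"
  using class_mean_shift[OF P_row_sum numbering v_eigen assms(2), of "Z n \<omega>"]
  by (simp add: Z_rec_noise[OF assms(1)] class_mean_eq_inner inner_add_right)

lemma AE_barrier:
  "AE \<omega> in M. (\<forall>h<d. (\<lambda>n. Y n h \<omega> * (1 - Y n h \<omega>)) \<longlonglongrightarrow> 0) \<and>
    (\<exists>k\<le>d. (\<lambda>n. \<Sum>h<d. Y n h \<omega>) \<longlonglongrightarrow> real k)"
  using noise_vanishes[OF v_pos v_eigen] AE_space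
proof eventually_elim
  case (elim \<omega>)
  have barrier: "(\<lambda>n. Y n h \<omega> * (1 - Y n h \<omega>)) \<longlonglongrightarrow> 0" if "h < d" for h
    using elim Z_01 X_range Z_rec
    by (intro reinforced_path_class_synchronization[where x = "\<lambda>n. X (Suc n) \<omega>" and A = P and r = r]
        P_nonneg P_row_sum P_irreducible numbering v_pos r_range r_div r_summable that)
       (auto simp: noise_def)
  \<comment> \<open>The cyclic shift only permutes the classes, so it drops out of the sum and the
    noise alone remains.\<close>
  have "(\<Sum>h<d. Y (Suc n) h \<omega>) - (\<Sum>h<d. Y n h \<omega>) = (\<Sum>h<d. class_mean v c (r n *\<^sub>R noise n \<omega>) h)" for n
  proof -
    have "(\<Sum>h<d. Y (Suc n) h \<omega>) = (1 - r n) * (\<Sum>h<d. Y n h \<omega>)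
        + r n * (\<Sum>h<d. Y n (Suc h mod d) \<omega>) + (\<Sum>h<d. class_mean v c (r n *\<^sub>R noise n \<omega>) h)"
      using elim by (simp add: Y_step sum.distrib sum_distrib_left)
    also have "(\<Sum>h<d. Y n (Suc h mod d) \<omega>) = (\<Sum>h<d. Y n h \<omega>)"
      using period_ge_2 by (intro sum_cyclic_shift) simp
    finally show ?thesis by (simp add: algebra_simps)
  qed
  moreover have "(\<lambda>n. \<Sum>h<d. class_mean v c (r n *\<^sub>R noise n \<omega>) h) \<longlonglongrightarrow> 0"
    using elim by (intro tendsto_null_sum class_mean_tendsto_0) simp
  ultimately have "(\<lambda>n. (\<Sum>h<d. Y (Suc n) h \<omega>) - (\<Sum>h<d. Y n h \<omega>)) \<longlonglongrightarrow> 0" by simp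
  then have "\<exists>k\<le>d. (\<lambda>n. \<Sum>h<d. Y n h \<omega>) \<longlonglongrightarrow> real k"
    using Y_01 elim barrier by (intro barrier_sum_converges_to_nat) auto
  with barrier show ?case by blast
qed

section \<open>The expected sum of absolute class differences\<close>

lemma D_F: "D n h \<in> borel_measurable (F n)"
  unfolding D_def using Y_F by measurable

lemma D_measurable [measurable]: "D n h \<in> borel_measurable M"
  by (rule borel_measurable_from_F[OF D_F])

lemma D_abs_le: "\<omega> \<in> space M \<Longrightarrow> h < d \<Longrightarrow> \<bar>D n h \<omega>\<bar> \<le> 1"
  using Y_01[of \<omega> h n] Y_01[of \<omega> "Suc h mod d" n] succ_less by (simp add: D_def abs_le_iff)

lemma D_integrable: "h < d \<Longrightarrow> integrable M (\<lambda>\<omega>. \<bar>D n h \<omega>\<bar>)"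
  using D_abs_le[of _ h n] by (intro integrable_bounded[of _ 1]) auto

lemma D_step:
  assumes "\<omega> \<in> space M" "h < d"
  shows "D (Suc n) h \<omega> = ((1 - r n) * D n h \<omega> + r n * D n (Suc h mod d) \<omega>)
    + (r n *\<^sub>R (class_vector v c h - class_vector v c (Suc h mod d))) \<bullet> noise n \<omega>"
  using assms succ_less
  by (simp add: D_def Y_step class_mean_eq_inner[of _ _ "r n *\<^sub>R noise n \<omega>"] inner_diff_left algebra_simps)

definition L :: "nat \<Rightarrow> real" where "L n = (\<Sum>h<d. expectation (\<lambda>\<omega>. \<bar>D n h \<omega>\<bar>))"

lemma L_nonneg: "0 \<le> L n"
  unfolding L_def by (intro sum_nonneg) simp

text \<open>Adding noise cannot decrease the expected absolute values. For the noise-free part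
  \<open>g\<close> the reverse triangle inequality is summed over the cycle, where both neighbors
  contribute the same total \<open>L n\<close>; this leaves the factor
  \<open>\<bar>1 - 2 * r n\<bar>\<close>.\<close>

lemma L_step: "(1 - 4 * (r n * (1 - r n))) * L n \<le> L (Suc n)"
proof -
  define g where "g = (\<lambda>h \<omega>. (1 - r n) * D n h \<omega> + r n * D n (Suc h mod d) \<omega>)"
  have g_F: "g h \<in> borel_measurable (F n)" for h
    unfolding g_def using D_F by measurable
  note g_F [THEN borel_measurable_from_F, measurable]
  have g_abs_le: "\<bar>g h \<omega>\<bar> \<le> 1" if "\<omega> \<in> space M" "h < d" for h \<omega>
  proof -
    have "\<bar>g h \<omega>\<bar> \<le> \<bar>(1 - r n) * D n h \<omega>\<bar> + \<bar>r n * D n (Suc h mod d) \<omega>\<bar>"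
      unfolding g_def by (rule abs_triangle_ineq)
    also have "\<dots> \<le> (1 - r n) * 1 + r n * 1"
      unfolding abs_mult using D_abs_le[OF that(1)] that(2) succ_less r_range[of n]
      by (intro add_mono mult_mono) auto
    finally show ?thesis by simp
  qed
  have g_int: "integrable M (\<lambda>\<omega>. \<bar>g h \<omega>\<bar>)" if "h < d" for h
    using g_abs_le that by (intro integrable_bounded[of _ 1]) auto
  define e where "e = (\<lambda>h. expectation (\<lambda>\<omega>. \<bar>D n h \<omega>\<bar>))"
  have shift: "(\<Sum>h<d. e (Suc h mod d)) = L n"
    unfolding L_def e_def[symmetric] using period_ge_2 by (intro sum_cyclic_shift) simp
  have le: "expectation (\<lambda>\<omega>. \<bar>g h \<omega>\<bar>) \<le> expectation (\<lambda>\<omega>. \<bar>D (Suc n) h \<omega>\<bar>)" if "h < d" for h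
  proof -
    have "expectation (\<lambda>\<omega>. \<bar>g h \<omega>\<bar>) \<le> expectation (\<lambda>\<omega>. \<bar>g h \<omega>
        + (r n *\<^sub>R (class_vector v c h - class_vector v c (Suc h mod d))) \<bullet> noise n \<omega>\<bar>)"
      using g_abs_le that by (intro expectation_abs_le_add_noise[of _ _ 1] g_F) auto
    also have "\<dots> = expectation (\<lambda>\<omega>. \<bar>D (Suc n) h \<omega>\<bar>)"
      using D_step[OF _ that] by (intro Bochner_Integration.integral_cong) (auto simp: g_def)
    finally show ?thesis .
  qed
  have lower: "(1 - r n) * e h - r n * e (Suc h mod d) \<le> expectation (\<lambda>\<omega>. \<bar>g h \<omega>\<bar>)"
    "r n * e (Suc h mod d) - (1 - r n) * e h \<le> expectation (\<lambda>\<omega>. \<bar>g h \<omega>\<bar>)" if h: "h < d" for h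
  proof -
    \<comment> \<open>Both directions are kept: the first is the useful one for \<open>r n\<close>
      below 1/2, the second above.\<close>
    have tri: "(1 - r n) * \<bar>x\<bar> - r n * \<bar>y\<bar> \<le> \<bar>(1 - r n) * x + r n * y\<bar>"
      "r n * \<bar>y\<bar> - (1 - r n) * \<bar>x\<bar> \<le> \<bar>(1 - r n) * x + r n * y\<bar>" for x y
    proof -
      have "\<bar>(1 - r n) * x\<bar> = (1 - r n) * \<bar>x\<bar>" "\<bar>r n * y\<bar> = r n * \<bar>y\<bar>"
        using r_range[of n] by (simp_all add: abs_mult)
      then show "(1 - r n) * \<bar>x\<bar> - r n * \<bar>y\<bar> \<le> \<bar>(1 - r n) * x + r n * y\<bar>"
        "r n * \<bar>y\<bar> - (1 - r n) * \<bar>x\<bar> \<le> \<bar>(1 - r n) * x + r n * y\<bar>"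
        by linarith+
    qed
    have "expectation (\<lambda>\<omega>. (1 - r n) * \<bar>D n h \<omega>\<bar> - r n * \<bar>D n (Suc h mod d) \<omega>\<bar>) \<le> expectation (\<lambda>\<omega>. \<bar>g h \<omega>\<bar>)"
      using tri(1) D_integrable[OF h] D_integrable[OF succ_less] g_int[OF h]
      by (intro integral_mono) (auto simp: g_def)
    then show "(1 - r n) * e h - r n * e (Suc h mod d) \<le> expectation (\<lambda>\<omega>. \<bar>g h \<omega>\<bar>)"
      using D_integrable[OF h] D_integrable[OF succ_less] by (simp add: e_def)
    have "expectation (\<lambda>\<omega>. r n * \<bar>D n (Suc h mod d) \<omega>\<bar> - (1 - r n) * \<bar>D n h \<omega>\<bar>) \<le> expectation (\<lambda>\<omega>. \<bar>g h \<omega>\<bar>)"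
      using tri(2) D_integrable[OF h] D_integrable[OF succ_less] g_int[OF h]
      by (intro integral_mono) (auto simp: g_def)
    then show "r n * e (Suc h mod d) - (1 - r n) * e h \<le> expectation (\<lambda>\<omega>. \<bar>g h \<omega>\<bar>)"
      using D_integrable[OF h] D_integrable[OF succ_less] by (simp add: e_def)
  qed
  have "(\<Sum>h<d. (1 - r n) * e h - r n * e (Suc h mod d)) \<le> L (Suc n)"
    "(\<Sum>h<d. r n * e (Suc h mod d) - (1 - r n) * e h) \<le> L (Suc n)"
    unfolding L_def by (intro sum_mono; use lower le in force)+
  then have "(1 - r n) * L n - r n * L n \<le> L (Suc n)" "r n * L n - (1 - r n) * L n \<le> L (Suc n)"
    unfolding sum_subtractf sum_distrib_left[symmetric] shift by (simp_all add: L_def e_def)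
  then have "\<bar>1 - 2 * r n\<bar> * L n \<le> L (Suc n)"
    by (cases "2 * r n \<le> 1") (simp_all add: algebra_simps)
  \<comment> \<open>A number in the unit interval is at least its square, and the square of
    \<open>1 - 2 * r n\<close> is \<open>1 - 4 * (r n * (1 - r n))\<close>.\<close>
  moreover have "1 - 4 * (r n * (1 - r n)) \<le> \<bar>1 - 2 * r n\<bar>"
  proof -
    have "\<bar>1 - 2 * r n\<bar> * \<bar>1 - 2 * r n\<bar> \<le> \<bar>1 - 2 * r n\<bar> * 1"
      using r_range[of n] by (intro mult_left_mono) auto
    then show ?thesis by (simp add: abs_mult_self_eq algebra_simps)
  qed
  ultimately show ?thesis
    using mult_right_mono[OF _ L_nonneg] order_trans by blast
qed

text \<open>The recursion for \<open>D\<close> leaves a linear combination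
  \<open>a \<bullet> noise n\<close> that vanishes almost surely. Its second moment is a sum over
  the components, so every component with a nonzero coefficient vanishes.\<close>

lemma noise_zero_of_D_zero:
  assumes rn: "r n > 0" and D0: "\<And>h. h < d \<Longrightarrow> AE \<omega> in M. D n h \<omega> = 0"
    and D1: "\<And>h. h < d \<Longrightarrow> AE \<omega> in M. D (Suc n) h \<omega> = 0"
  shows "AE \<omega> in M. noise n \<omega> = 0"
proof -
  have "AE \<omega> in M. noise n \<omega> $ i = 0" for i
  proof -
    define h where "h = c i"
    have h: "h < d" unfolding h_def by (rule cyclic_numbering_less[OF numbering])
    define a where "a = r n *\<^sub>R (class_vector v c h - class_vector v c (Suc h mod d))"
    \<comment> \<open>With at least two classes, the coefficient at \<open>i\<close> comes from
      class \<open>h\<close> alone and is not cancelled.\<close>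
    have "h \<noteq> Suc h mod d" using period_ge_2 h by (auto simp: mod_Suc)
    moreover have "0 < (\<Sum>j\<in>{j. c j = h}. v $ j)"
      using v_pos by (intro sum_pos) (auto simp: h_def)
    ultimately have a_i: "a $ i \<noteq> 0"
      using rn v_pos[of i] by (simp add: a_def class_vector_def flip: h_def)
    have "AE \<omega> in M. a \<bullet> noise n \<omega> = 0"
      using D0[OF h] D0[OF succ_less[of h]] D1[OF h] AE_space
      by eventually_elim (use D_step[OF _ h] in \<open>simp add: a_def\<close>)
    then have "expectation (\<lambda>\<omega>. (0 + a \<bullet> noise n \<omega>)\<^sup>2) = 0"
      by (intro integral_eq_zero_AE) auto
    moreover have "expectation (\<lambda>\<omega>. (0 + a \<bullet> noise n \<omega>)\<^sup>2) =
        expectation (\<lambda>\<omega>. 0\<^sup>2) + (\<Sum>i\<in>UNIV. (a $ i)\<^sup>2 * expectation (\<lambda>\<omega>. (noise n \<omega> $ i)\<^sup>2))"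
      by (rule second_moment_noise[of _ _ 0]) auto
    ultimately have "(\<Sum>i\<in>UNIV. (a $ i)\<^sup>2 * expectation (\<lambda>\<omega>. (noise n \<omega> $ i)\<^sup>2)) = 0" by simp
    then have "(a $ i)\<^sup>2 * expectation (\<lambda>\<omega>. (noise n \<omega> $ i)\<^sup>2) = 0"
      by (subst (asm) sum_nonneg_eq_0_iff) auto
    then have "expectation (\<lambda>\<omega>. (noise n \<omega> $ i)\<^sup>2) = 0" using a_i by simp
    moreover have "integrable M (\<lambda>\<omega>. (noise n \<omega> $ i)\<^sup>2)"
      using noise_abs_le[of _ n i] by (intro integrable_bounded[of _ 1]) (auto simp: abs_square_le_1)
    ultimately have "AE \<omega> in M. (noise n \<omega> $ i)\<^sup>2 = 0"
      by (subst (asm) integral_nonneg_eq_0_iff_AE) auto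
    then show ?thesis by simp
  qed
  then have "AE \<omega> in M. \<forall>i. noise n \<omega> $ i = 0" by (simp add: AE_all_countable)
  then show ?thesis by (simp add: vec_eq_iff)
qed

lemma Z_backwards:
  assumes \<omega>: "\<omega> \<in> space M" and "m \<le> n" and b: "Z n \<omega> $ j = b" "b \<in> {0, 1}"
  shows "Z m \<omega> $ j = b"
  using assms(2)
\<comment> \<open>One step backwards: the later value is an extreme point of the unit interval, and
  the earlier state enters it with positive weight.\<close>
proof (induction m rule: inc_induct)
  case (step m)
  have "(1 - r m) * Z m \<omega> $ j + r m * X (Suc m) \<omega> $ j = b"
    using step Z_component_rec[OF \<omega>, of m j] by simp
  then show ?case
    using convex_combination_extreme(1) Z_01[OF \<omega>] X_01[OF \<omega>] r_range b(2) by metis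
qed (fact b)

text \<open>A noise-free step forces \<open>P *v Z n\<close>, hence \<open>Z n\<close>, to be a 0/1 vector, and reading the
  dynamics backwards makes the state at the previous noise-free step harmonic.\<close>

lemma trivial_start_of_noiseless_steps:
  assumes \<omega>: "\<omega> \<in> space M" and mn: "m < n" and rm: "r m > 0"
    and noise: "noise m \<omega> = 0" "noise n \<omega> = 0"
  shows "Z 0 \<omega> = 0 \<or> Z 0 \<omega> = 1"
proof -
  have Zn: "Z n \<omega> $ j \<in> {0, 1}" for j
  proof -
    \<comment> \<open>Column \<open>j\<close> of \<open>P\<close> is not zero, since
      \<open>v\<close> is stationary and positive; so component \<open>j\<close> enters the average
      at some index \<open>l\<close>.\<close>
    have "0 < (\<Sum>l\<in>UNIV. v $ l * P $ l $ j)"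
      using v_pos[of j] left_eigenvector_component[OF v_eigen, of j] by simp
    then obtain l where "v $ l * P $ l $ j > 0"
      using sum_nonpos[of UNIV "\<lambda>l. v $ l * P $ l $ j"] leD[of "sum _ _" 0] not_less by metis
    then have l: "P $ l $ j > 0" using v_pos[of l] by (simp add: zero_less_mult_iff)
    have f: "0 \<le> Z n \<omega> $ i * (1 - Z n \<omega> $ i)" for i using Z_01[OF \<omega>, of n i] by simp
    have "P $ l $ j * (Z n \<omega> $ j * (1 - Z n \<omega> $ j)) \<le> (\<Sum>i\<in>UNIV. P $ l $ i * (Z n \<omega> $ i * (1 - Z n \<omega> $ i)))"
      using P_nonneg f
      by (intro member_le_sum[of j UNIV "\<lambda>i. P $ l $ i * (Z n \<omega> $ i * (1 - Z n \<omega> $ i))"]) auto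
    also have "\<dots> \<le> (P *v Z n \<omega>) $ l * (1 - (P *v Z n \<omega>) $ l)"
      unfolding matrix_vector_mult_def vec_lambda_beta
      by (rule average_logistic_le) (simp_all add: P_nonneg P_row_sum)
    also have "\<dots> = 0"
      using noise(2) X_range[OF \<omega>, of n l] by (auto simp: noise_def)
    finally have "P $ l $ j * (Z n \<omega> $ j * (1 - Z n \<omega> $ j)) = 0"
      using f[of j] l by (intro antisym) auto
    then show ?thesis using l by auto
  qed
  have Zm: "Z k \<omega> $ j = Z n \<omega> $ j" if "k \<le> n" for k j
    using Z_backwards[OF \<omega> that refl Zn] .
  have Xm: "X (Suc m) \<omega> $ j = Z n \<omega> $ j" for j
  proof -
    have "(1 - r m) * Z m \<omega> $ j + r m * X (Suc m) \<omega> $ j = Z n \<omega> $ j"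
      using Zm[of "Suc m" j] mn Z_component_rec[OF \<omega>, of m j] by simp
    then show ?thesis
      using convex_combination_extreme(2) Z_01[OF \<omega>] X_01[OF \<omega>] r_range Zn rm by metis
  qed
  have X: "X (Suc m) \<omega> = Z n \<omega>" unfolding vec_eq_iff using Xm by blast
  have Zk: "Z k \<omega> = Z n \<omega>" if "k \<le> n" for k
    unfolding vec_eq_iff using Zm[OF that] by blast
  \<comment> \<open>Without noise at time \<open>m\<close>, \<open>P *v Z m\<close> equals
    \<open>X (Suc m)\<close>, and both \<open>Z m\<close> and \<open>X (Suc m)\<close> equal
    \<open>Z n\<close>.\<close>
  have "P *v Z n \<omega> = Z n \<omega>"
    using noise(1) X Zk[of m] mn unfolding noise_def by simp
  from harmonic_01_trivial[OF P_nonneg P_irreducible this Zn] show ?thesis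
    unfolding Zk[OF le0] .
qed

text \<open>From some time on the total loss is at most 1/2, so \<open>L k\<close> stays at least
  half of \<open>L n\<close> for all \<open>k \<ge> n\<close>; a limit 0 then forces
  \<open>L n = 0\<close>.\<close>

lemma L_eventually_zero_of_tendsto_0:
  assumes "L \<longlonglongrightarrow> 0"
  shows "\<exists>m. \<forall>n\<ge>m. L n = 0"
proof -
  obtain T where T: "T \<longlonglongrightarrow> 0" and tail: "\<And>n m. (\<Sum>k\<in>{n..<m}. r k * (1 - r k)) \<le> T n"
    using eventually_zero_or_one_rates[OF r_range r_div r_summable] by metis
  \<comment> \<open>The losses are four times the terms of the series, so 1/8 keeps their sum below
    1/2.\<close>
  have "eventually (\<lambda>n. T n < 1 / 8) sequentially"
    using T by (intro order_tendstoD(2)[of T 0]) auto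
  then obtain m where m: "\<And>n. n \<ge> m \<Longrightarrow> T n < 1 / 8" by (auto simp: eventually_sequentially)
  have "L n = 0" if n: "n \<ge> m" for n
  proof -
    define S where "S = (\<lambda>k. 4 * (\<Sum>i\<in>{n..<k}. r i * (1 - r i)))"
    have rr: "0 \<le> r k * (1 - r k)" for k using r_range[of k] by simp
    have S: "0 \<le> S k" "S k \<le> 1 / 2" for k
      using tail[of n k] m[OF n] sum_nonneg[of "{n..<k}" "\<lambda>i. r i * (1 - r i)"] rr by (auto simp: S_def)
    \<comment> \<open>Weierstrass' product inequality in inductive form:
      \<open>(1 - s) * (1 - S k) \<ge> 1 - (S k + s)\<close>.\<close>
    have "(1 - S k) * L n \<le> L k" if "k \<ge> n" for k
      using that
    proof (induction k rule: dec_induct)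
      case (step k)
      define s where "s = 4 * (r k * (1 - r k))"
      have Suc: "S (Suc k) = S k + s" using step by (simp add: S_def s_def)
      have s: "0 \<le> s" "s \<le> 1" using rr[of k] Suc S(1)[of k] S(2)[of "Suc k"] by (auto simp: s_def)
      have "(1 - S (Suc k)) * L n \<le> (1 - s) * (1 - S k) * L n"
        using S(1)[of k] s L_nonneg[of n] by (intro mult_right_mono) (auto simp: Suc algebra_simps)
      also have "\<dots> \<le> (1 - s) * L k"
        using step.IH s by (simp add: mult.assoc mult_left_mono)
      also have "\<dots> \<le> L (Suc k)" using L_step[of k] by (simp add: s_def)
      finally show ?case .
    qed (simp add: S_def)
    moreover have "1 / 2 * L n \<le> (1 - S k) * L n" for k
      using S(2)[of k] L_nonneg[of n] by (intro mult_right_mono) auto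
    ultimately have "1 / 2 * L n \<le> L k" if "k \<ge> n" for k
      using that order_trans by blast
    then have "1 / 2 * L n \<le> 0"
      using LIMSEQ_le_const[OF assms] by blast
    then show ?thesis using L_nonneg[of n] by simp
  qed
  then show ?thesis by blast
qed

text \<open>A sum near 0 or near \<open>d\<close> puts all class means near the same barrier, so
  each \<open>D n h\<close> tends to 0. By dominated convergence \<open>L\<close> tends to 0, hence
  is eventually 0, and two later noise-free steps determine the start.\<close>

lemma trivial_start_of_total_synchronization:
  assumes sync: "AE \<omega> in M. (\<lambda>n. \<Sum>h<d. Y n h \<omega>) \<longlonglongrightarrow> 0 \<or> (\<lambda>n. \<Sum>h<d. Y n h \<omega>) \<longlonglongrightarrow> real d"
  shows "AE \<omega> in M. Z 0 \<omega> = 0 \<or> Z 0 \<omega> = 1"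
proof -
  have D_lim: "AE \<omega> in M. (\<lambda>n. \<bar>D n h \<omega>\<bar>) \<longlonglongrightarrow> 0" if h: "h < d" for h
    using sync AE_space
  proof eventually_elim
    case (elim \<omega>)
    note Y01 = Y_01[OF elim(2)]
    have upper: "Y n k \<omega> \<le> (\<Sum>h<d. Y n h \<omega>)" if "k < d" for n k
      using Y01 that by (intro member_le_sum[of k "{..<d}" "\<lambda>h. Y n h \<omega>"]) auto
    have lower: "1 - Y n k \<omega> \<le> real d - (\<Sum>h<d. Y n h \<omega>)" if "k < d" for n k
    proof -
      have "1 - Y n k \<omega> \<le> (\<Sum>h<d. 1 - Y n h \<omega>)"
        using Y01 that by (intro member_le_sum[of k "{..<d}" "\<lambda>h. 1 - Y n h \<omega>"]) auto
      then show ?thesis by (simp add: sum_subtractf)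
    qed
    have "\<bar>D n h \<omega>\<bar> \<le> (\<Sum>h<d. Y n h \<omega>)" "\<bar>D n h \<omega>\<bar> \<le> real d - (\<Sum>h<d. Y n h \<omega>)" for n
      using upper[OF h, of n] upper[OF succ_less, of n h] lower[OF h, of n] lower[OF succ_less, of n h]
        Y01[OF h, of n] Y01[OF succ_less, of n h]
      unfolding D_def by linarith+
    then have bounds: "\<forall>\<^sub>F n in sequentially. norm \<bar>D n h \<omega>\<bar> \<le> (\<Sum>h<d. Y n h \<omega>)"
      "\<forall>\<^sub>F n in sequentially. norm \<bar>D n h \<omega>\<bar> \<le> real d - (\<Sum>h<d. Y n h \<omega>)"
      by simp_all
    from elim(1) show ?case
    proof
      assume "(\<lambda>n. \<Sum>h<d. Y n h \<omega>) \<longlonglongrightarrow> 0"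
      then show ?thesis by (rule Lim_null_comparison[OF bounds(1)])
    next
      assume "(\<lambda>n. \<Sum>h<d. Y n h \<omega>) \<longlonglongrightarrow> real d"
      then have "(\<lambda>n. real d - (\<Sum>h<d. Y n h \<omega>)) \<longlonglongrightarrow> 0"
        using tendsto_diff[OF tendsto_const[of "real d"]] by fastforce
      then show ?thesis by (rule Lim_null_comparison[OF bounds(2)])
    qed
  qed
  have "(\<lambda>n. expectation (\<lambda>\<omega>. \<bar>D n h \<omega>\<bar>)) \<longlonglongrightarrow> expectation (\<lambda>\<omega>. 0)" if "h < d" for h
    using D_lim[OF that] D_abs_le[OF _ that]
    by (intro integral_dominated_convergence[where w = "\<lambda>_. 1"]) auto
  then have "L \<longlonglongrightarrow> 0"
    unfolding L_def by (intro tendsto_null_sum) simp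
  then obtain m where m: "\<And>n. n \<ge> m \<Longrightarrow> L n = 0"
    using L_eventually_zero_of_tendsto_0 by blast
  have D0: "AE \<omega> in M. D n h \<omega> = 0" if n: "n \<ge> m" and h: "h < d" for n h
  proof -
    have "expectation (\<lambda>\<omega>. \<bar>D n h \<omega>\<bar>) = 0"
      using m[OF n] h unfolding L_def by (subst (asm) sum_nonneg_eq_0_iff) auto
    then have "AE \<omega> in M. \<bar>D n h \<omega>\<bar> = 0"
      using D_integrable[OF h] by (subst (asm) integral_nonneg_eq_0_iff_AE) auto
    then show ?thesis by simp
  qed
  \<comment> \<open>Noise can be read off from \<open>D\<close> only at times with a positive rate;
    divergence of the sum supplies such times arbitrarily late.\<close>
  have active: "\<exists>n\<ge>k. r n > 0" for k
  proof (rule ccontr)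
    assume "\<not> ?thesis"
    then have zero: "r n = 0" if "n \<ge> k" for n using r_range[of n] that by force
    have "(\<Sum>i<n. r i) \<le> (\<Sum>i<k. r i)" for n
    proof -
      have "(\<Sum>i<n. r i) \<le> (\<Sum>i<max n k. r i)" using r_range by (intro sum_mono2) auto
      also have "\<dots> = (\<Sum>i<k. r i)" using zero by (intro sum.mono_neutral_right) auto
      finally show ?thesis .
    qed
    moreover have "\<exists>n. (\<Sum>i<k. r i) + 1 \<le> (\<Sum>i<n. r i)"
      using r_div by (auto simp: filterlim_at_top eventually_sequentially)
    ultimately show False by (metis add_le_same_cancel1 not_one_le_zero order_trans)
  qed
  obtain n where n: "n \<ge> m" "r n > 0" using active by blast
  obtain n' where n': "n' \<ge> Suc n" "r n' > 0" using active by blast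
  have "AE \<omega> in M. noise n \<omega> = 0" "AE \<omega> in M. noise n' \<omega> = 0"
    using n n' by (auto intro!: noise_zero_of_D_zero D0)
  then show ?thesis
    using AE_space
    by eventually_elim (use trivial_start_of_noiseless_steps[of _ n n'] n n' in auto)
qed

end

section \<open>Barrier convergence, the limiting count and its nontriviality\<close>

theorem theorem3p3:
  fixes W :: "real^'n^'n" and v :: "real^'n" and c :: "'n \<Rightarrow> nat"
    and r :: "nat \<Rightarrow> real"
    and M :: "'a measure"
    and Z X :: "nat \<Rightarrow> 'a \<Rightarrow> real^'n"
  defines "nper \<equiv> period (transpose W)"
    and "F \<equiv> history M (Z 0) X"
  defines "Zc \<equiv> \<lambda>n h \<omega>. class_mean v c (Z n \<omega>) h"
  assumes N_ge_2: "CARD('n) \<ge> 2"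
    and W_nonneg: "\<And>i j. W $ i $ j \<ge> 0"
    and W_irred: "irreducible_nonneg W"
    and W_stoch: "transpose W *v 1 = 1"
    and c: "cyclic_numbering (transpose W) c"
    and v_pos: "\<And>i. v $ i > 0"
    and v_eigen: "v v* transpose W = v"
    and v_sum: "(\<Sum>i\<in>UNIV. v $ i) = 1"
    and r_range: "\<And>n. 0 \<le> r n \<and> r n < 1"
    and M: "prob_space M"
    and Z0_rv: "Z 0 \<in> borel_measurable M"
    and Z0_range: "\<And>\<omega> l. \<omega> \<in> space M \<Longrightarrow> 0 \<le> Z 0 \<omega> $ l \<and> Z 0 \<omega> $ l \<le> 1"
    and Z0_nontriv: "measure M {\<omega> \<in> space M. Z 0 \<omega> = 0} + measure M {\<omega> \<in> space M. Z 0 \<omega> = 1} < 1"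
    and X_rv: "\<And>n. X (Suc n) \<in> borel_measurable M"
    and X_range: "\<And>n \<omega> l. \<omega> \<in> space M \<Longrightarrow> X (Suc n) \<omega> $ l \<in> {0, 1}"
    and X_indep: "\<And>n. cond_indep_vars M (F n) (\<lambda>l \<omega>. X (Suc n) \<omega> $ l) UNIV"
    and X_prob: "\<And>n l. AE \<omega> in M.
        real_cond_exp M (F n) (indicator {\<omega> \<in> space M. X (Suc n) \<omega> $ l = 1}) \<omega>
          = (transpose W *v Z n \<omega>) $ l"
    and Z_rec: "\<And>n \<omega>. \<omega> \<in> space M \<Longrightarrow>
        Z (Suc n) \<omega> = (1 - r n) *\<^sub>R Z n \<omega> + r n *\<^sub>R X (Suc n) \<omega>"
    and nper_ge_2: "nper \<ge> 2"
    and r_div: "filterlim (\<lambda>n. \<Sum>k<n. r k) at_top sequentially"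
    and r_summable: "summable (\<lambda>n. r n * (1 - r n))"
  shows "(\<forall>h<nper. AE \<omega> in M. (\<lambda>n. Zc n h \<omega> * (1 - Zc n h \<omega>)) \<longlonglongrightarrow> 0) \<and>
    (\<exists>Ninf :: 'a \<Rightarrow> nat.
        Ninf \<in> measurable M (count_space UNIV) \<and>
        (\<forall>\<omega>\<in>space M. Ninf \<omega> \<le> nper) \<and>
        measure M {\<omega> \<in> space M. Ninf \<omega> = 0} + measure M {\<omega> \<in> space M. Ninf \<omega> = nper} < 1 \<and>
        (\<forall>\<epsilon>::real. 0 < \<epsilon> \<and> \<epsilon> < 1 / 2 \<longrightarrow>
          (AE \<omega> in M. (\<lambda>n. real (card {h. h < nper \<and> Zc n h \<omega> \<ge> 1 - \<epsilon>}))
             \<longlonglongrightarrow> real (Ninf \<omega>)) \<and>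
          (AE \<omega> in M. (\<lambda>n. real (card {h. h < nper \<and> Zc n h \<omega> \<le> \<epsilon>}))
             \<longlonglongrightarrow> real nper - real (Ninf \<omega>))))"
proof -
  interpret prob_space M by (rule M)
  have row: "(\<Sum>j\<in>UNIV. transpose W $ i $ j) = 1" for i
    using W_stoch by (simp add: vec_eq_iff matrix_vector_mult_def)
  have nonneg: "transpose W $ i $ j \<ge> 0" for i j
    using W_nonneg by (simp add: transpose_def)
  interpret cyclic_reinforced_process M "transpose W" r Z X c v
    by (intro cyclic_reinforced_process.intro reinforced_process.intro
        cyclic_reinforced_process_axioms.intro reinforced_process_axioms.intro
        M nonneg row r_range Z0_rv Z0_range X_rv X_range X_indep[unfolded F_def]
        X_prob[unfolded F_def] Z_rec irreducible_nonneg_transpose W_irred c v_pos v_eigen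
        nper_ge_2[unfolded nper_def] r_div r_summable)
  define S where "S = (\<lambda>n \<omega>. \<Sum>h<nper. Zc n h \<omega>)"
  \<comment> \<open>Rounding and capping make this a measurable function with values up to
    \<open>nper\<close> everywhere, including the null set where the sums may fail to converge;
    elsewhere it is their integer limit.\<close>
  define Ninf where "Ninf = (\<lambda>\<omega>. min nper (nat \<lfloor>lim (\<lambda>n. S n \<omega>)\<rfloor>))"
  have limits: "AE \<omega> in M. (\<forall>h<nper. (\<lambda>n. Zc n h \<omega> * (1 - Zc n h \<omega>)) \<longlonglongrightarrow> 0) \<and>
      (\<lambda>n. S n \<omega>) \<longlonglongrightarrow> real (Ninf \<omega>)"
    using AE_barrier unfolding nper_def[symmetric] Zc_def[symmetric]
  proof eventually_elim
    case (elim \<omega>)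
    then obtain k where k: "k \<le> nper" "(\<lambda>n. S n \<omega>) \<longlonglongrightarrow> real k" by (auto simp: S_def Zc_def)
    then have "lim (\<lambda>n. S n \<omega>) = real k" by (intro limI)
    with k have "Ninf \<omega> = k" by (simp add: Ninf_def)
    with k elim show ?case by (simp add: Zc_def)
  qed
  have S_measurable: "S n \<in> borel_measurable M" for n
    unfolding S_def Zc_def by measurable
  then have Ninf_measurable: "Ninf \<in> measurable M (count_space UNIV)"
    unfolding Ninf_def by measurable
  have counts: "AE \<omega> in M. (\<lambda>n. real (card {h. h < nper \<and> Zc n h \<omega> \<ge> 1 - \<epsilon>})) \<longlonglongrightarrow> real (Ninf \<omega>)"
    "AE \<omega> in M. (\<lambda>n. real (card {h. h < nper \<and> Zc n h \<omega> \<le> \<epsilon>})) \<longlonglongrightarrow> real nper - real (Ninf \<omega>)"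
    if \<epsilon>: "0 < \<epsilon>" "\<epsilon> < 1 / 2" for \<epsilon> :: real
  proof -
    have Zc01: "0 \<le> Zc n h \<omega> \<and> Zc n h \<omega> \<le> 1" if "\<omega> \<in> space M" "h < nper" for n h \<omega>
      using Y_01[OF that[unfolded nper_def]] by (simp add: Zc_def)
    show "AE \<omega> in M. (\<lambda>n. real (card {h. h < nper \<and> Zc n h \<omega> \<ge> 1 - \<epsilon>})) \<longlonglongrightarrow> real (Ninf \<omega>)"
      using limits AE_space
    proof eventually_elim
      case (elim \<omega>)
      have "(\<lambda>n. real (card {h. h < nper \<and> 1 - \<epsilon> \<le> Zc n h \<omega>}) - S n \<omega>) \<longlonglongrightarrow> 0"
        unfolding S_def using elim Zc01 \<epsilon> by (intro barrier_counts_tendsto(1)) auto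
      from tendsto_add[OF this conjunct2[OF elim(1)]] show ?case by simp
    qed
    show "AE \<omega> in M. (\<lambda>n. real (card {h. h < nper \<and> Zc n h \<omega> \<le> \<epsilon>})) \<longlonglongrightarrow> real nper - real (Ninf \<omega>)"
      using limits AE_space
    proof eventually_elim
      case (elim \<omega>)
      have "(\<lambda>n. real (card {h. h < nper \<and> Zc n h \<omega> \<le> \<epsilon>}) - (real nper - S n \<omega>)) \<longlonglongrightarrow> 0"
        unfolding S_def using elim Zc01 \<epsilon> by (intro barrier_counts_tendsto(2)) auto
      from tendsto_add[OF this tendsto_diff[OF tendsto_const[of "real nper"] conjunct2[OF elim(1)]]]
      show ?case by simp
    qed
  qed
  have disjoint_prob: "prob {\<omega> \<in> space M. g \<omega> = a} + prob {\<omega> \<in> space M. g \<omega> = b}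
      = prob {\<omega> \<in> space M. g \<omega> = a \<or> g \<omega> = b}"
    if "{\<omega> \<in> space M. g \<omega> = a} \<in> events" "{\<omega> \<in> space M. g \<omega> = b} \<in> events" "a \<noteq> b"
    for g :: "'a \<Rightarrow> 'c" and a b
    using that by (subst finite_measure_Union[symmetric]) (auto intro: arg_cong[of _ _ prob])
  \<comment> \<open>Otherwise the sums of class means would almost surely tend to 0 or
    \<open>nper\<close>, which makes the initial state almost surely constant 0 or constant 1,
    against \<open>Z0_nontriv\<close>.\<close>
  have nontrivial: "prob {\<omega> \<in> space M. Ninf \<omega> = 0} + prob {\<omega> \<in> space M. Ninf \<omega> = nper} < 1"
  proof (rule ccontr)
    assume "\<not> ?thesis"
    moreover have ev: "{\<omega> \<in> space M. Ninf \<omega> = k} \<in> events" for k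
      using Ninf_measurable by measurable
    ultimately have "1 \<le> prob {\<omega> \<in> space M. Ninf \<omega> = 0 \<or> Ninf \<omega> = nper}"
      using disjoint_prob[OF ev ev, of 0 nper] nper_ge_2 by simp
    then have "prob {\<omega> \<in> space M. Ninf \<omega> = 0 \<or> Ninf \<omega> = nper} = 1"
      by (intro antisym prob_le_1)
    then have "AE \<omega> in M. Ninf \<omega> = 0 \<or> Ninf \<omega> = nper"
      by (rule AE_prob_1[THEN AE_mp]) auto
    then have "AE \<omega> in M. (\<lambda>n. S n \<omega>) \<longlonglongrightarrow> 0 \<or> (\<lambda>n. S n \<omega>) \<longlonglongrightarrow> real nper"
      using limits by eventually_elim auto
    then have trivial: "AE \<omega> in M. Z 0 \<omega> = 0 \<or> Z 0 \<omega> = 1"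
      unfolding S_def Zc_def nper_def by (rule trivial_start_of_total_synchronization)
    have ev0: "{\<omega> \<in> space M. Z 0 \<omega> = a} \<in> events" for a
      using Z0_rv by measurable
    have "{\<omega> \<in> space M. Z 0 \<omega> = 0 \<or> Z 0 \<omega> = 1} \<in> events"
      using sets.Un[OF ev0[of 0] ev0[of 1]] by (simp add: Collect_disj_eq conj_disj_distribL)
    then have "prob {\<omega> \<in> space M. Z 0 \<omega> = 0 \<or> Z 0 \<omega> = 1} = 1"
      using trivial by (simp add: prob_Collect_eq_1)
    then show False
      using Z0_nontriv disjoint_prob[OF ev0 ev0, of 0 1] by (simp add: vec_eq_iff)
  qed
  show ?thesis
  proof (intro conjI exI[of _ Ninf] allI impI)
    show "AE \<omega> in M. (\<lambda>n. Zc n h \<omega> * (1 - Zc n h \<omega>)) \<longlonglongrightarrow> 0" if "h < nper" for h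
      using limits by eventually_elim (use that in blast)
    show "\<forall>\<omega>\<in>space M. Ninf \<omega> \<le> nper" by (simp add: Ninf_def)
  qed (use Ninf_measurable nontrivial counts in auto)
qed

end
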